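(* Let $X$ be a set and $X'$ a locally compact Hausdorff space. Suppose that $K:X\times X'\to\mathbb{R}$ satisfies $K(x,\cdot)\in C_0(X')$ for every $x\in X$ and that $\mathrm{span}\{K(x,\cdot):x\in X\}$ is dense in $C_0(X')$; let $\mathcal{B}_K$ be the associated RKBS. Let $x_1,\dots,x_n$ be distinct points of $X$ such that $K(x_1,\cdot),\dots,K(x_n,\cdot)$ are linearly independent in $C_0(X')$, and put $\mathcal{V}:=\mathrm{span}\{K(x_j,\cdot):j=1,\dots,n\}$ and $\mathcal{L}(f):=[f(x_j)]_{j=1}^n$ for $f\in\mathcal{B}_K$. Let $\mathbf{y}_0\in\mathbb{R}^n$, $\lambda>0$, let $\mathcal{Q}_{\mathbf{y}_0}:\mathbb{R}^n\to[0,+\infty)$ be lower semi-continuous and convex, and let $\mathrm{R}(\mathbf{y}_0)$ be the set of solutions of $$\inf\{\mathcal{Q}_{\mathbf{y}_0}(\mathcal{L}(f))+\lambda\|f\|_{\mathcal{B}_K}:f\in\mathcal{B}_K\}.$$ If for every nonzero $g\in\mathcal{V}$ the set $\mathcal{N}(g)$ is finite, then every nonzero extreme point $\hat f$ of $\mathrm{R}(\mathbf{y}_0)$ has the form $$\hat f=\sum_{j=1}^M\alpha_jK(\cdot,x_j')$$ for some nonzero $\hat g\in\mathcal{V}$, some positive integer $M\le\mathrm{rank}(\mathbf{V}_{\hat g})$, some $\alpha_j\neq0$, $j=1,\dots,M$, with $\sum_{j=1}^M|\alpha_j|=\|\hat g\|_\infty$, and some $x_j'\in\mathcal{N}(\hat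 g)$, $j=1,\dots,M$.
   Context: $C_0(X')$ is the Banach space of continuous $f:X'\to\mathbb{R}$ such that $\{x':|f(x')|\ge\epsilon\}$ is compact for all $\epsilon>0$, with the norm $\|f\|_\infty=\sup_{x'\in X'}|f(x')|$. $\mathfrak{M}(X')$ is the space of real-valued regular Borel measures on $X'$ with total variation norm $\|\cdot\|_{\mathrm{TV}}$ (the dual of $C_0(X')$). The space $\mathcal{B}_K$ of functions on $X$ is $$\mathcal{B}_K:=\Bigl\{f_\mu:=\int_{X'}K(\cdot,x')\,d\mu(x'):\mu\in\mathfrak{M}(X')\Bigr\},\qquad\|f_\mu\|_{\mathcal{B}_K}:=\|\mu\|_{\mathrm{TV}}$$ (by the density condition $\mu\mapsto f_\mu$ is injective). For $g\in C_0(X')$: $\mathcal{N}(g):=\{x'\in X':|g(x')|=\|g\|_\infty\}$. For nonzero $g\in\mathcal{V}$ with $\mathcal{N}(g)$ finite, let $n(g)$ be the cardinality of $\mathcal{N}(g)=\{t_1',\dots,t'_{n(g)}\}$ and $\mathbf{V}_g:=[K(x_i,t_j')]_{1\le i\le n,\,1\le j\le n(g)}\in\mathbb{R}^{n\times n(g)}$. *)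

theory Defs
  imports "HOL-Analysis.Analysis" "HOL-Library.Function_Algebras"
begin

text \<open>Pointwise vector space structure on real functions, so that the library notion
  \<^const>\<open>extreme_point_of\<close> applies to sets of functions.\<close>

instantiation "fun" :: (type, real_vector) real_vector
begin

definition scaleR_fun :: "real \<Rightarrow> ('a \<Rightarrow> 'b) \<Rightarrow> 'a \<Rightarrow> 'b"
  where "scaleR_fun c f = (\<lambda>x. c *\<^sub>R f x)"

instance
  by standard (auto simp: scaleR_fun_def scaleR_add_right scaleR_add_left fun_eq_iff)

end

lemma scaleR_fun_apply [simp]: "(c *\<^sub>R f) x = c *\<^sub>R f x"
  by (simp add: scaleR_fun_def)


definition C0_functions :: "('b::topological_space \<Rightarrow> real) set"
  where "C0_functions = {f. continuous_on UNIV f \<and> (\<forall>\<epsilon>>0. compact {t. \<epsilon> \<le> \<bar>f t\<bar>})}"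

text \<open>The normed space \<open>C\<^sub>0\<close> is the following subspace of the Banach space of bounded continuous
  functions, whose norm is the supremum norm. Boundedness is no restriction, see below.\<close>

definition C0 :: "('b::topological_space \<Rightarrow>\<^sub>C real) set"
  where "C0 = Bcontfun ` C0_functions"

lemma C0_functions_subset_bcontfun: "C0_functions \<subseteq> bcontfun"
proof
  fix f :: "'a \<Rightarrow> real"
  assume f: "f \<in> C0_functions"
  then have cont: "continuous_on UNIV f" and "compact {t. 1 \<le> \<bar>f t\<bar>}"
    by (auto simp: C0_functions_def)
  then have "compact (f ` {t. 1 \<le> \<bar>f t\<bar>})"
    by (meson compact_continuous_image continuous_on_subset subset_UNIV)
  then have "bounded (f ` {t. 1 \<le> \<bar>f t\<bar>} \<union> cball 0 1)"
    by (simp add: compact_imp_bounded)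
  moreover have "range f \<subseteq> f ` {t. 1 \<le> \<bar>f t\<bar>} \<union> cball 0 1"
    by (auto simp: image_iff)
  ultimately have "bounded (range f)"
    using bounded_subset by blast
  with cont show "f \<in> bcontfun"
    by (simp add: bcontfun_def)
qed

lemma C0_eq: "C0 = {g. \<forall>\<epsilon>>0. compact {t. \<epsilon> \<le> \<bar>apply_bcontfun g t\<bar>}}"
proof (intro set_eqI iffI)
  fix g :: "'a \<Rightarrow>\<^sub>C real"
  assume "g \<in> C0"
  then obtain f where f: "f \<in> C0_functions" "g = Bcontfun f"
    by (auto simp: C0_def)
  with C0_functions_subset_bcontfun have "apply_bcontfun g = f"
    by (auto simp: Bcontfun_inverse)
  with f show "g \<in> {g. \<forall>\<epsilon>>0. compact {t. \<epsilon> \<le> \<bar>apply_bcontfun g t\<bar>}}"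
    by (auto simp: C0_functions_def)
next
  fix g :: "'a \<Rightarrow>\<^sub>C real"
  assume "g \<in> {g. \<forall>\<epsilon>>0. compact {t. \<epsilon> \<le> \<bar>apply_bcontfun g t\<bar>}}"
  then have "apply_bcontfun g \<in> C0_functions"
    by (auto simp: C0_functions_def)
  then show "g \<in> C0"
    unfolding C0_def by (metis apply_bcontfun_inverse imageI)
qed

definition norm_set :: "('b::topological_space \<Rightarrow>\<^sub>C real) \<Rightarrow> 'b set"
  where "norm_set g = {t. \<bar>apply_bcontfun g t\<bar> = norm g}"


definition variation :: "('b::topological_space set \<Rightarrow> real) \<Rightarrow> 'b set \<Rightarrow> ennreal"
  where "variation \<mu> A =
    (SUP P\<in>{P. finite P \<and> P \<subseteq> sets borel \<and> partition_on A P}. ennreal (\<Sum>E\<in>P. \<bar>\<mu> E\<bar>))"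

text \<open>Real-valued regular Borel measures. A measure is a set function defined on the Borel sets only;
  the value \<open>0\<close> on all other sets makes its representation as a total function unique.\<close>

definition signed_regular_measures :: "('b::topological_space set \<Rightarrow> real) set"
  where "signed_regular_measures = {\<mu>.
    (\<forall>A. A \<notin> sets borel \<longrightarrow> \<mu> A = 0) \<and>
    (\<forall>A. range A \<subseteq> sets borel \<and> disjoint_family A \<longrightarrow>
       (\<lambda>i::nat. \<mu> (A i)) sums \<mu> (\<Union>i. A i)) \<and>
    (\<forall>A\<in>sets borel.
       variation \<mu> A = (INF U\<in>{U. open U \<and> A \<subseteq> U}. variation \<mu> U) \<and>
       variation \<mu> A = (SUP C\<in>{C. compact C \<and> C \<subseteq> A}. variation \<mu> C))}"

definition tv_norm :: "('b::topological_space set \<Rightarrow> real) \<Rightarrow> real"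
  where "tv_norm \<mu> = enn2real (variation \<mu> UNIV)"

text \<open>The positive part in the Jordan decomposition of \<open>\<mu>\<close>; the negative part is the positive part of
  \<open>- \<mu>\<close>. The integral against \<open>\<mu>\<close> is the difference of the integrals against the two parts.\<close>

definition positive_part :: "('b::topological_space set \<Rightarrow> real) \<Rightarrow> 'b measure"
  where "positive_part \<mu> =
    measure_of UNIV (sets borel) (\<lambda>A. SUP B\<in>{B. B \<in> sets borel \<and> B \<subseteq> A}. ennreal (\<mu> B))"

definition signed_integral :: "('b::topological_space set \<Rightarrow> real) \<Rightarrow> ('b \<Rightarrow> real) \<Rightarrow> real"
  where "signed_integral \<mu> h =
    (LINT t|positive_part \<mu>. h t) - (LINT t|positive_part (\<lambda>A. - \<mu> A). h t)"


definition rkbs_fun :: "('a \<Rightarrow> 'b::topological_space \<Rightarrow> real) \<Rightarrow> ('b set \<Rightarrow> real) \<Rightarrow> 'a \<Rightarrow> real"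
  where "rkbs_fun K \<mu> = (\<lambda>x. signed_integral \<mu> (K x))"

definition rkbs :: "('a \<Rightarrow> 'b::topological_space \<Rightarrow> real) \<Rightarrow> ('a \<Rightarrow> real) set"
  where "rkbs K = rkbs_fun K ` signed_regular_measures"

text \<open>When the functions \<open>K x\<close> span a dense subspace of \<open>C\<^sub>0\<close> over a locally compact Hausdorff
  space, the measure representing a member of \<^term>\<open>rkbs K\<close> is unique.\<close>

definition rkbs_norm :: "('a \<Rightarrow> 'b::topological_space \<Rightarrow> real) \<Rightarrow> ('a \<Rightarrow> real) \<Rightarrow> real"
  where "rkbs_norm K f = tv_norm (THE \<mu>. \<mu> \<in> signed_regular_measures \<and> f = rkbs_fun K \<mu>)"

definition sampling :: "('n::finite \<Rightarrow> 'a) \<Rightarrow> ('a \<Rightarrow> real) \<Rightarrow> real ^ 'n"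
  where "sampling x f = (\<chi> i. f (x i))"

definition kernel_span ::
    "('a \<Rightarrow> 'b::topological_space \<Rightarrow> real) \<Rightarrow> ('n \<Rightarrow> 'a) \<Rightarrow> ('b \<Rightarrow>\<^sub>C real) set"
  where "kernel_span K x = span (range (\<lambda>i. Bcontfun (K (x i))))"

definition lower_semicontinuous :: "('c::topological_space \<Rightarrow> real) \<Rightarrow> bool"
  where "lower_semicontinuous q \<longleftrightarrow> (\<forall>z. \<forall>c<q z. eventually (\<lambda>w. c < q w) (nhds z))"

definition regularized_solutions ::
    "('a \<Rightarrow> 'b::topological_space \<Rightarrow> real) \<Rightarrow> ('n::finite \<Rightarrow> 'a) \<Rightarrow> (real ^ 'n \<Rightarrow> real) \<Rightarrow> real
      \<Rightarrow> ('a \<Rightarrow> real) set"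
  where "regularized_solutions K x q r =
    {f. is_arg_min (\<lambda>h. q (sampling x h) + r * rkbs_norm K h) (\<lambda>h. h \<in> rkbs K) f}"


text \<open>A matrix whose set of columns is a finite set varying inside a statement: the columns are
  indexed by \<open>J\<close> itself instead of by an enumeration of \<open>J\<close>. For any enumeration of \<open>J\<close> by a type the
  rank defined here is the library rank of the enumerated matrix.\<close>

definition rank_on :: "'j set \<Rightarrow> ('n::finite \<Rightarrow> 'j \<Rightarrow> real) \<Rightarrow> nat"
  where "rank_on J A = dim ((\<lambda>j. (\<chi> i. A i j) :: real ^ 'n) ` J)"

lemma rank_on_eq_rank:
  fixes e :: "'m::finite \<Rightarrow> 'j" and A :: "'n::finite \<Rightarrow> 'j \<Rightarrow> real"
  assumes "bij_betw e UNIV J"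
  shows "rank_on J A = rank ((\<chi> i k. A i (e k)) :: real ^ 'm ^ 'n)"
proof -
  have "(\<lambda>j. (\<chi> i. A i j) :: real ^ 'n) ` J = columns ((\<chi> i k. A i (e k)) :: real ^ 'm ^ 'n)"
    using bij_betw_imp_surj_on[OF assms] by (auto simp: columns_def column_def image_iff)
  then show ?thesis
    by (simp add: rank_on_def column_rank_def)
qed

definition node_matrix ::
    "('a \<Rightarrow> 'b \<Rightarrow> real) \<Rightarrow> ('n \<Rightarrow> 'a) \<Rightarrow> 'n \<Rightarrow> 'b \<Rightarrow> real"
  where "node_matrix K x = (\<lambda>i t. K (x i) t)"

end

theory Submission
  imports Defs
begin

text \<open>
  Write \<open>f = f\<^sub>\<mu>\<close>, \<open>m = \<parallel>\<mu>\<parallel>\<close>, \<open>k t = (K (x i) t)\<^sub>i\<close> and \<open>y = sampling x f\<close>. Among the functions with the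
  samples \<open>y\<close> the data term is constant, so \<open>f\<close> has the least norm among them. In particular a discrete
  measure with weights \<open>\<beta> t\<close> satisfies \<open>\<Sum>\<bar>\<beta> t\<bar> \<ge> m\<close> whenever \<open>\<Sum>\<beta> t k t = y\<close>, so \<open>y / m\<close> is not interior
  to the absolutely convex hull of the vectors \<open>k t\<close>. A hyperplane through it
  (\<open>supporting_functional\<close>) yields coefficients \<open>c\<close> such that \<open>g = \<Sum>c\<^sub>i K (x i)\<close> satisfies
  \<open>\<integral>g d\<mu> = c \<bullet> y \<ge> m \<parallel>g\<parallel>\<close>.

  A measure that attains its norm on \<open>g\<close> is carried by the points where \<open>\<bar>g\<bar> = \<parallel>g\<parallel>\<close> and has there the sign of
  \<open>g\<close> (\<open>norming_imp_concentrated\<close>). These points are finitely many, so \<open>f\<close> is a finite combination of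
  kernel sections. If the columns \<open>k t\<close> at the atoms satisfied a nontrivial relation, a small
  multiple of it could be added to and subtracted from the weights: the samples stay \<open>y\<close>, the norm
  stays \<open>m\<close> because no sign changes and the relation integrates \<open>g\<close> to zero, and \<open>f\<close> becomes the
  midpoint of two distinct solutions. So for an extreme point the columns are independent, and there
  are at most as many atoms as the rank.

  The norm of \<open>f\<close> is defined through the measure that represents it, so the argument
  rests on two facts about real-valued regular measures: their total variation is finite, by the Hahn
  decomposition (\<open>Hahn_decomposition\<close>, \<open>Jordan_decomposition\<close>), and they are determined by the
  integrals of the kernel sections (\<open>inj_on_rkbs_fun\<close>), by regularity and Urysohn's lemma.
\<close>

section \<open>Hahn and Jordan decompositions\<close>

locale signed_measure =
  fixes M :: "'b measure" and \<mu> :: "'b set \<Rightarrow> real"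
  assumes sums_UN: "range A \<subseteq> sets M \<Longrightarrow> disjoint_family A \<Longrightarrow> (\<lambda>i::nat. \<mu> (A i)) sums \<mu> (\<Union>i. A i)"
begin

lemma empty [simp]: "\<mu> {} = 0"
proof -
  have "(\<lambda>i::nat. \<mu> {}) sums \<mu> {}"
    using sums_UN[of "\<lambda>_. {}"] by (simp add: disjoint_family_on_def)
  then show ?thesis
    using LIMSEQ_unique summable_LIMSEQ_zero sums_summable tendsto_const by blast
qed

lemma Un:
  assumes "A \<in> sets M" "B \<in> sets M" "A \<inter> B = {}"
  shows "\<mu> (A \<union> B) = \<mu> A + \<mu> B"
proof -
  have "(\<lambda>i. \<mu> (binaryset A B i)) sums \<mu> (\<Union>i. binaryset A B i)"
    using assms by (intro sums_UN) (auto simp: range_binaryset_eq disjoint_family_on_def binaryset_def)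
  moreover have "(\<lambda>i. \<mu> (binaryset A B i)) sums (\<mu> A + \<mu> B)"
    by (rule binaryset_sums) simp
  ultimately show ?thesis
    by (simp add: UN_binaryset_eq sums_unique2)
qed

lemma split:
  assumes "A \<in> sets M" "B \<in> sets M"
  shows "\<mu> A = \<mu> (A \<inter> B) + \<mu> (A - B)"
  using Un[of "A \<inter> B" "A - B"] assms by (simp add: Int_Diff_disjoint Int_Diff_Un)

lemma Union:
  assumes "finite P" "P \<subseteq> sets M" "disjoint P"
  shows "\<mu> (\<Union>P) = (\<Sum>E\<in>P. \<mu> E)"
  using assms
proof (induction P rule: finite_induct)
  case (insert E P)
  have "E \<inter> \<Union>P = {}"
    using insert.prems insert.hyps by (auto simp: disjoint_def)
  moreover have "\<Union>P \<in> sets M"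
    using insert by (auto intro!: sets.finite_Union)
  ultimately have "\<mu> (E \<union> \<Union>P) = \<mu> E + \<mu> (\<Union>P)"
    using insert.prems by (intro Un) auto
  then show ?case
    using insert by (simp add: disjoint_def)
qed simp

definition positive_on :: "'b set \<Rightarrow> bool"
  where "positive_on P \<longleftrightarrow> P \<in> sets M \<and> (\<forall>B\<in>sets M. B \<subseteq> P \<longrightarrow> 0 \<le> \<mu> B)"

text \<open>Cutting out of \<open>D\<close>, again and again, a subset whose measure is at least half as negative as possible
  leaves a positive set: the pieces are disjoint, so their measures form a convergent series and tend
  to \<open>0\<close>, and what is left has no subset of negative measure. Nothing is known yet about finiteness of
  the infimum over subsets, which is why the greed of each step is truncated at \<open>-1\<close>.\<close>

lemma ex_positive_subset:
  assumes D: "D \<in> sets M"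
  obtains P where "P \<subseteq> D" "positive_on P" "\<mu> D \<le> \<mu> P"
proof -
  have step: "\<exists>B. B \<in> sets M \<and> B \<subseteq> A \<and> \<mu> B \<le> 0 \<and> (\<forall>C\<in>sets M. C \<subseteq> A \<longrightarrow> \<mu> B \<le> max (\<mu> C / 2) (-1))"
    if A: "A \<in> sets M" for A
  proof (cases "\<exists>B\<in>sets M. B \<subseteq> A \<and> \<mu> B \<le> -1")
    case True
    then obtain B where "B \<in> sets M" "B \<subseteq> A" "\<mu> B \<le> -1"
      by blast
    then show ?thesis
      by (intro exI[of _ B]) (auto simp: le_max_iff_disj)
  next
    case False
    define S where "S = \<mu> ` {B \<in> sets M. B \<subseteq> A}"
    have bdd: "bdd_below S"
      using False by (intro bdd_belowI[of _ "-1"]) (auto simp: S_def not_le intro: less_imp_le)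
    have Inf_le: "Inf S \<le> \<mu> C" if "C \<in> sets M" "C \<subseteq> A" for C
      using that bdd by (intro cInf_lower) (auto simp: S_def)
    show ?thesis
    proof (cases "Inf S < 0")
      case True
      then have "Inf S < Inf S / 2" by simp
      moreover have "S \<noteq> {}"
        using A by (auto simp: S_def)
      ultimately obtain s where "s \<in> S" "s < Inf S / 2"
        using cInf_lessD by blast
      then obtain B where B: "B \<in> sets M" "B \<subseteq> A" "\<mu> B < Inf S / 2"
        by (auto simp: S_def)
      have "\<mu> B \<le> \<mu> C / 2" if "C \<in> sets M" "C \<subseteq> A" for C
        using B(3) Inf_le[OF that] by linarith
      with B True show ?thesis
        by (intro exI[of _ B]) (auto simp: le_max_iff_disj)
    next
      case False
      then have "0 \<le> \<mu> C" if "C \<in> sets M" "C \<subseteq> A" for C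
        using Inf_le[OF that] by linarith
      then show ?thesis
        by (intro exI[of _ "{}"]) (auto simp: le_max_iff_disj)
    qed
  qed
  then obtain b where b: "\<And>A. A \<in> sets M \<Longrightarrow> b A \<in> sets M" "\<And>A. A \<in> sets M \<Longrightarrow> b A \<subseteq> A"
    "\<And>A. A \<in> sets M \<Longrightarrow> \<mu> (b A) \<le> 0"
    "\<And>A C. A \<in> sets M \<Longrightarrow> C \<in> sets M \<Longrightarrow> C \<subseteq> A \<Longrightarrow> \<mu> (b A) \<le> max (\<mu> C / 2) (-1)"
    by metis
  define A where "A n = ((\<lambda>X. X - b X) ^^ n) D" for n
  have A_Suc: "A (Suc n) = A n - b (A n)" for n
    by (simp add: A_def)
  have A_sets: "A n \<in> sets M" for n
    by (induction n) (use D b in \<open>auto simp: A_def\<close>)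
  have "decseq A"
    by (auto simp: decseq_Suc_iff A_Suc)
  then have disj: "b (A m) \<inter> b (A n) = {}" if "m < n" for m n
    using that A_Suc[of m] b(2)[OF A_sets[of n]] decseqD[of A "Suc m" n] by fastforce
  have "disjoint_family (\<lambda>n. b (A n))"
    unfolding disjoint_family_on_def
  proof (intro ballI impI)
    fix m n :: nat
    assume "m \<noteq> n"
    then show "b (A m) \<inter> b (A n) = {}"
      using disj[of m n] disj[of n m] by (cases "m < n") auto
  qed
  then have sums: "(\<lambda>n. \<mu> (b (A n))) sums \<mu> (\<Union>n. b (A n))"
    using b(1) A_sets by (intro sums_UN) auto
  then have lim: "(\<lambda>n. \<mu> (b (A n))) \<longlonglongrightarrow> 0"
    using sums_summable summable_LIMSEQ_zero by blast
  have U_sets: "(\<Union>n. b (A n)) \<in> sets M"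
    using b(1) A_sets by auto
  define P where "P = D - (\<Union>n. b (A n))"
  have P_A: "P \<subseteq> A n" for n
    by (induction n) (auto simp: P_def A_Suc, simp add: A_def)
  show thesis
  proof
    show "P \<subseteq> D"
      by (auto simp: P_def)
    have "0 \<le> \<mu> C" if C: "C \<in> sets M" "C \<subseteq> P" for C
    proof -
      have "\<mu> (b (A n)) \<le> max (\<mu> C / 2) (-1)" for n
        using C P_A by (intro b(4) A_sets) auto
      then have "0 \<le> max (\<mu> C / 2) (-1)"
        using lim by (intro LIMSEQ_le_const2) auto
      then show ?thesis
        by (simp add: le_max_iff_disj)
    qed
    then show "positive_on P"
      using D U_sets by (auto simp: positive_on_def P_def)
    have "\<mu> (\<Union>n. b (A n)) \<le> 0"
      using b(3)[OF A_sets] by (intro sums_le[OF _ sums sums_zero]) auto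
    moreover have "b (A n) \<subseteq> D" for n
      using b(2)[OF A_sets[of n]] decseqD[OF \<open>decseq A\<close>, of 0 n] by (auto simp: A_def)
    then have "D \<inter> (\<Union>n. b (A n)) = (\<Union>n. b (A n))"
      by blast
    ultimately show "\<mu> D \<le> \<mu> P"
      using split[OF D U_sets] by (simp add: P_def)
  qed
qed

lemma positive_on_mono: "positive_on P \<Longrightarrow> B \<in> sets M \<Longrightarrow> B \<subseteq> P \<Longrightarrow> \<mu> B \<le> \<mu> P"
  using split[of P B] by (auto simp: positive_on_def Int_absorb1)

lemma positive_on_UN:
  assumes "\<And>n::nat. positive_on (P n)"
  shows "positive_on (\<Union>n. P n)"
  unfolding positive_on_def
proof (intro conjI ballI impI)
  have P: "P n \<in> sets M" for n
    using assms by (simp add: positive_on_def)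
  then show "(\<Union>n. P n) \<in> sets M"
    by auto
  fix B assume B: "B \<in> sets M" "B \<subseteq> (\<Union>n. P n)"
  have dP: "disjointed P n \<in> sets M" for n
    using sets.range_disjointed_sets[of P M] P by auto
  have "(\<lambda>n. \<mu> (B \<inter> disjointed P n)) sums \<mu> (\<Union>n. B \<inter> disjointed P n)"
    using B dP
    by (intro sums_UN disjoint_family_on_bisimulation[OF disjoint_family_disjointed[of P]]) auto
  then have sums: "(\<lambda>n. \<mu> (B \<inter> disjointed P n)) sums \<mu> B"
    using B(2) UN_disjointed_eq[of P] by (simp add: Int_UN_distrib[symmetric] Int_absorb2)
  have "0 \<le> \<mu> (B \<inter> disjointed P n)" for n
  proof -
    have "B \<inter> disjointed P n \<subseteq> P n"
      using disjointed_subset[of P n] by blast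
    then show ?thesis
      using assms[of n] B(1) dP[of n] by (simp add: positive_on_def)
  qed
  then show "0 \<le> \<mu> B"
    by (rule sums_le[OF _ sums_zero sums])
qed

text \<open>A countable union of positive sets can be chosen to have the largest measure that a positive set can
  have. Outside of it a set of positive measure would contain a positive set of positive measure, which
  would increase the maximum. As the maximum is the value of \<open>\<mu>\<close> at a set, it is finite, and with it
  the total variation.\<close>

lemma Hahn_decomposition:
  obtains H where "H \<in> sets M" "\<And>A. A \<in> sets M \<Longrightarrow> 0 \<le> \<mu> (A \<inter> H)"
    "\<And>A. A \<in> sets M \<Longrightarrow> \<mu> (A - H) \<le> 0"
proof -
  let ?val = "\<lambda>P. ereal (\<mu> P)"
  have "positive_on {}"
    by (auto simp: positive_on_def)
  then have "{P. positive_on P} \<noteq> {}"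
    by blast
  from SUP_countable_SUP[OF this, of ?val] obtain f :: "nat \<Rightarrow> ereal"
    where f: "range f \<subseteq> ?val ` {P. positive_on P}" "(SUP P\<in>{P. positive_on P}. ?val P) = Sup (range f)"
    by blast
  from f(1) have "\<forall>n. \<exists>P. positive_on P \<and> f n = ?val P"
    by fastforce
  then obtain P where P: "\<And>n. positive_on (P n)" "\<And>n. f n = ?val (P n)"
    by metis
  define H where "H = (\<Union>n. P n)"
  have H: "positive_on H"
    unfolding H_def using P(1) by (rule positive_on_UN)
  have max: "\<mu> Q \<le> \<mu> H" if "positive_on Q" for Q
  proof -
    have "?val Q \<le> (SUP P\<in>{P. positive_on P}. ?val P)"
      using that by (intro SUP_upper) auto
    also have "\<dots> \<le> ?val H"
      unfolding f(2)
    proof (rule SUP_least)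
      fix n
      have "\<mu> (P n) \<le> \<mu> H"
        using H P(1)[of n] by (intro positive_on_mono) (auto simp: H_def positive_on_def)
      then show "f n \<le> ?val H"
        using P(2) by simp
    qed
    finally show ?thesis by simp
  qed
  have H_sets: "H \<in> sets M"
    using H by (simp add: positive_on_def)
  show thesis
  proof
    show "H \<in> sets M" by (fact H_sets)
    show "0 \<le> \<mu> (A \<inter> H)" if "A \<in> sets M" for A
      using H that by (auto simp: positive_on_def)
    show "\<mu> (A - H) \<le> 0" if "A \<in> sets M" for A
    proof -
      have "A - H \<in> sets M"
        using H_sets that by blast
      then obtain P where P: "P \<subseteq> A - H" "positive_on P" "\<mu> (A - H) \<le> \<mu> P"
        by (rule ex_positive_subset)
      have "positive_on (if n = 0 then H else P)" for n :: nat
        using H P(2) by simp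
      then have "positive_on (\<Union>n::nat. if n = 0 then H else P)"
        by (rule positive_on_UN)
      moreover have "(\<Union>n::nat. if n = 0 then H else P) = H \<union> P"
      proof
        show "H \<union> P \<subseteq> (\<Union>n::nat. if n = 0 then H else P)"
          by (intro Un_least UN_upper[of 0, THEN subset_trans[rotated]]
            UN_upper[of 1, THEN subset_trans[rotated]]) auto
      qed auto
      ultimately have "positive_on (H \<union> P)"
        by simp
      then have "\<mu> (H \<union> P) \<le> \<mu> H"
        by (rule max)
      moreover have "\<mu> (H \<union> P) = \<mu> H + \<mu> P"
        using P H by (intro Un) (auto simp: positive_on_def)
      ultimately show ?thesis
        using P(3) by simp
    qed
  qed
qed

lemma uminus_signed_measure: "signed_measure M (\<lambda>A. - \<mu> A)"
proof
  fix A :: "nat \<Rightarrow> 'b set"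
  assume "range A \<subseteq> sets M" "disjoint_family A"
  then show "(\<lambda>i. - \<mu> (A i)) sums - \<mu> (\<Union>i. A i)"
    by (intro sums_minus sums_UN)
qed

end

abbreviation negative_part :: "('b::topological_space set \<Rightarrow> real) \<Rightarrow> 'b measure"
  where "negative_part \<mu> \<equiv> positive_part (\<lambda>A. - \<mu> A)"

lemma sets_positive_part [simp, measurable_cong]: "sets (positive_part \<mu>) = sets borel"
  unfolding positive_part_def using sets.sigma_sets_eq[of borel] by simp

lemma space_positive_part [simp]: "space (positive_part \<mu>) = UNIV"
  by (simp add: positive_part_def space_measure_of_conv)

text \<open>For a Hahn set \<open>H\<close>, the supremum that defines the positive part is attained at \<open>A \<inter> H\<close>, and the
  supremum that defines the variation at the partition of \<open>A\<close> into \<open>A \<inter> H\<close> and \<open>A - H\<close>. So all three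
  are finite, and everything about \<open>\<mu>\<close> reduces to two finite positive measures.\<close>

lemma Jordan_decomposition:
  fixes \<mu> :: "'b::topological_space set \<Rightarrow> real"
  assumes "signed_measure borel \<mu>"
  shows "finite_measure (positive_part \<mu>)" "finite_measure (negative_part \<mu>)"
    and "\<And>A. A \<in> sets borel \<Longrightarrow>
      \<mu> A = measure (positive_part \<mu>) A - measure (negative_part \<mu>) A"
    and "\<And>A. A \<in> sets borel \<Longrightarrow> variation \<mu> A =
      ennreal (measure (positive_part \<mu>) A + measure (negative_part \<mu>) A)"
proof -
  interpret signed_measure borel \<mu> by fact
  interpret m: signed_measure borel "\<lambda>A. - \<mu> A" by (rule uminus_signed_measure)
  obtain H where H: "H \<in> sets borel" "\<And>A. A \<in> sets borel \<Longrightarrow> 0 \<le> \<mu> (A \<inter> H)"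
    "\<And>A. A \<in> sets borel \<Longrightarrow> \<mu> (A - H) \<le> 0"
    using Hahn_decomposition by blast
  have part: "finite_measure (positive_part \<nu>) \<and> (\<forall>A\<in>sets borel. measure (positive_part \<nu>) A = \<nu> (A \<inter> G))"
    if \<nu>: "signed_measure borel \<nu>" and G: "G \<in> sets borel" "\<And>A. A \<in> sets borel \<Longrightarrow> 0 \<le> \<nu> (A \<inter> G)"
      "\<And>A. A \<in> sets borel \<Longrightarrow> \<nu> (A - G) \<le> 0" for \<nu> :: "'b set \<Rightarrow> real" and G
  proof -
    interpret n: signed_measure borel \<nu> by fact
    define v where "v = (\<lambda>A. SUP B\<in>{B. B \<in> sets borel \<and> B \<subseteq> A}. ennreal (\<nu> B))"
    have v: "v A = ennreal (\<nu> (A \<inter> G))" if A: "A \<in> sets borel" for A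
    proof (rule antisym)
      show "ennreal (\<nu> (A \<inter> G)) \<le> v A"
        unfolding v_def using A G(1) by (intro SUP_upper) auto
      show "v A \<le> ennreal (\<nu> (A \<inter> G))"
        unfolding v_def
      proof (rule SUP_least)
        fix B assume "B \<in> {B. B \<in> sets borel \<and> B \<subseteq> A}"
        then have B: "B \<in> sets borel" "B \<subseteq> A" by auto
        have "\<nu> (A \<inter> G) = \<nu> (B \<inter> G) + \<nu> ((A - B) \<inter> G)"
        proof -
          have "A \<inter> G \<inter> B = B \<inter> G" "A \<inter> G - B = (A - B) \<inter> G"
            using B(2) by auto
          then show ?thesis
            using n.split[of "A \<inter> G" B] A B(1) G(1) by simp
        qed
        then have "\<nu> B \<le> \<nu> (A \<inter> G)"
          using n.split[of B G] B A G(1) G(2)[of "A - B"] G(3)[of B] by auto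
        then show "ennreal (\<nu> B) \<le> ennreal (\<nu> (A \<inter> G))"
          by (rule ennreal_leI)
      qed
    qed
    have pp: "positive_part \<nu> = measure_of UNIV (sets borel) v"
      by (simp add: positive_part_def v_def)
    have sets: "sets (positive_part \<nu>) = sets borel" by (rule sets_positive_part)
    have "emeasure (positive_part \<nu>) A = v A" if "A \<in> sets borel" for A
      using pp
    proof (rule emeasure_measure_of)
      show "positive (sets (positive_part \<nu>)) v"
        by (simp add: positive_def v)
      show "countably_additive (sets (positive_part \<nu>)) v"
        unfolding countably_additive_def sets
      proof (intro allI impI)
        fix A :: "nat \<Rightarrow> 'b set"
        assume A: "range A \<subseteq> sets borel" "disjoint_family A" "(\<Union>i. A i) \<in> sets borel"
        have "(\<lambda>i. \<nu> (A i \<inter> G)) sums \<nu> (\<Union>i. A i \<inter> G)"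
          using A(1) G(1) by (intro n.sums_UN disjoint_family_on_bisimulation[OF A(2)]) auto
        then have "(\<Sum>i. ennreal (\<nu> (A i \<inter> G))) = ennreal (\<nu> (\<Union>i. A i \<inter> G))"
          using A(1) G(2) by (intro sums_unique[symmetric]) (auto simp: sums_ennreal image_subset_iff)
        also have "(\<Union>i. A i \<inter> G) = (\<Union>i. A i) \<inter> G"
          by auto
        finally show "(\<Sum>i. v (A i)) = v (\<Union>i. A i)"
          using A by (simp add: v image_subset_iff)
      qed
    qed (use that sets in auto)
    then have em: "emeasure (positive_part \<nu>) A = ennreal (\<nu> (A \<inter> G))" if "A \<in> sets borel" for A
      using v that by simp
    have "finite_measure (positive_part \<nu>)"
      using em[of UNIV] by (intro finite_measureI) (simp add: pp space_measure_of_conv)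
    moreover have "measure (positive_part \<nu>) A = \<nu> (A \<inter> G)" if "A \<in> sets borel" for A
      using em[OF that] G(2)[OF that] by (simp add: measure_def)
    ultimately show ?thesis by blast
  qed
  have p: "finite_measure (positive_part \<mu>)"
    "\<And>A. A \<in> sets borel \<Longrightarrow> measure (positive_part \<mu>) A = \<mu> (A \<inter> H)"
    using part[OF signed_measure_axioms H] by blast+
  have "- H \<in> sets borel"
    using H(1) by (simp add: borel_comp)
  moreover have "0 \<le> - \<mu> (A \<inter> - H)" if "A \<in> sets borel" for A
    using H(3)[OF that] by (simp add: Diff_eq)
  moreover have "- \<mu> (A - - H) \<le> 0" if "A \<in> sets borel" for A
    using H(2)[OF that] by (simp add: Diff_eq)
  ultimately have "finite_measure (negative_part \<mu>) \<and>
      (\<forall>A\<in>sets borel. measure (negative_part \<mu>) A = - \<mu> (A \<inter> - H))"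
    by (rule part[OF m.signed_measure_axioms])
  then have n: "finite_measure (negative_part \<mu>)"
    "\<And>A. A \<in> sets borel \<Longrightarrow> measure (negative_part \<mu>) A = - \<mu> (A - H)"
    by (simp_all add: Diff_eq)
  show "finite_measure (positive_part \<mu>)" "finite_measure (negative_part \<mu>)"
    by fact+
  fix A :: "'b set" assume A: "A \<in> sets borel"
  show "\<mu> A = measure (positive_part \<mu>) A - measure (negative_part \<mu>) A"
    using split[OF A H(1)] p(2)[OF A] n(2)[OF A] by simp
  have "variation \<mu> A = ennreal (\<mu> (A \<inter> H) - \<mu> (A - H))"
    unfolding variation_def
  proof (rule antisym)
    show "(SUP P\<in>{P. finite P \<and> P \<subseteq> sets borel \<and> partition_on A P}. ennreal (\<Sum>E\<in>P. \<bar>\<mu> E\<bar>)) \<le>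
        ennreal (\<mu> (A \<inter> H) - \<mu> (A - H))"
    proof (intro SUP_least ennreal_leI)
      fix P assume "P \<in> {P. finite P \<and> P \<subseteq> sets borel \<and> partition_on A P}"
      then have P: "finite P" "P \<subseteq> sets borel" "disjoint P" "A = \<Union>P"
        by (auto simp: partition_on_def)
      have "(\<Sum>E\<in>P. \<bar>\<mu> E\<bar>) \<le> (\<Sum>E\<in>P. measure (positive_part \<mu>) E + measure (negative_part \<mu>) E)"
      proof (rule sum_mono)
        fix E assume "E \<in> P"
        then have "E \<in> sets borel" using P by auto
        then show "\<bar>\<mu> E\<bar> \<le> measure (positive_part \<mu>) E + measure (negative_part \<mu>) E"
          using split[of E H] p(2)[of E] n(2)[of E] H(1) H(2)[of E] H(3)[of E] by simp
      qed
      also have "\<dots> = measure (positive_part \<mu>) A + measure (negative_part \<mu>) A"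
        using P by (simp add: sum.distrib)
          (simp add: finite_measure.finite_measure_finite_Union[OF p(1), of P "\<lambda>E. E", symmetric]
            finite_measure.finite_measure_finite_Union[OF n(1), of P "\<lambda>E. E", symmetric]
            disjoint_family_on_def disjoint_def)
      finally show "(\<Sum>E\<in>P. \<bar>\<mu> E\<bar>) \<le> \<mu> (A \<inter> H) - \<mu> (A - H)"
        using p(2)[OF A] n(2)[OF A] by simp
    qed
  next
    let ?P = "{A \<inter> H, A - H} - {{}}"
    have "(\<Sum>E\<in>?P. \<bar>\<mu> E\<bar>) = (\<Sum>E\<in>{A \<inter> H, A - H}. \<bar>\<mu> E\<bar>)"
      by (rule sum.mono_neutral_left) auto
    also have "\<dots> = \<mu> (A \<inter> H) - \<mu> (A - H)"
    proof (cases "A \<inter> H = A - H")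
      case True
      then have empties: "A \<inter> H = {}" "A - H = {}" by blast+
      show ?thesis unfolding empties by simp
    next
      case False
      then show ?thesis using H(2)[OF A] H(3)[OF A] by simp
    qed
    finally have "ennreal (\<mu> (A \<inter> H) - \<mu> (A - H)) = ennreal (\<Sum>E\<in>?P. \<bar>\<mu> E\<bar>)"
      by simp
    also have "\<dots> \<le> (SUP P\<in>{P. finite P \<and> P \<subseteq> sets borel \<and> partition_on A P}. ennreal (\<Sum>E\<in>P. \<bar>\<mu> E\<bar>))"
      using A H(1) by (intro SUP_upper) (auto simp: partition_on_def disjoint_def)
    finally show "ennreal (\<mu> (A \<inter> H) - \<mu> (A - H)) \<le> \<dots>" .
  qed
  then show "variation \<mu> A = ennreal (measure (positive_part \<mu>) A + measure (negative_part \<mu>) A)"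
    using p(2)[OF A] n(2)[OF A] by simp
qed

section \<open>Integration against a signed Borel measure\<close>

lemma signed_regular_imp_signed_measure:
  "\<mu> \<in> signed_regular_measures \<Longrightarrow> signed_measure borel \<mu>"
  by (auto simp: signed_regular_measures_def signed_measure_def)

text \<open>The finite, real-valued counterpart of \<^const>\<open>variation\<close>.\<close>

definition total_variation :: "('b::topological_space set \<Rightarrow> real) \<Rightarrow> 'b set \<Rightarrow> real"
  where "total_variation \<mu> A = measure (positive_part \<mu>) A + measure (negative_part \<mu>) A"

locale signed_borel_measure = signed_measure borel \<mu> for \<mu> :: "'b::topological_space set \<Rightarrow> real"
begin

sublocale pos: finite_measure "positive_part \<mu>"
  using Jordan_decomposition(1)[OF signed_measure_axioms] .

sublocale neg: finite_measure "negative_part \<mu>"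
  using Jordan_decomposition(2)[OF signed_measure_axioms] .

lemma Jordan: "A \<in> sets borel \<Longrightarrow> \<mu> A = measure (positive_part \<mu>) A - measure (negative_part \<mu>) A"
  using Jordan_decomposition(3)[OF signed_measure_axioms] .

lemma variation_eq: "A \<in> sets borel \<Longrightarrow> variation \<mu> A = ennreal (total_variation \<mu> A)"
  unfolding total_variation_def using Jordan_decomposition(4)[OF signed_measure_axioms] .

lemma total_variation_nonneg [simp]: "0 \<le> total_variation \<mu> A"
  by (simp add: total_variation_def)

lemma tv_norm_eq: "tv_norm \<mu> = total_variation \<mu> UNIV"
  by (simp add: tv_norm_def variation_eq)

lemma total_variation_mono:
  "A \<subseteq> B \<Longrightarrow> B \<in> sets borel \<Longrightarrow> total_variation \<mu> A \<le> total_variation \<mu> B"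
  by (simp add: total_variation_def pos.finite_measure_mono neg.finite_measure_mono add_mono)

lemma total_variation_Diff:
  "A \<subseteq> B \<Longrightarrow> A \<in> sets borel \<Longrightarrow> B \<in> sets borel \<Longrightarrow>
    total_variation \<mu> (B - A) = total_variation \<mu> B - total_variation \<mu> A"
  by (simp add: total_variation_def pos.finite_measure_Diff neg.finite_measure_Diff)

lemma abs_le_total_variation: "A \<in> sets borel \<Longrightarrow> \<bar>\<mu> A\<bar> \<le> total_variation \<mu> A"
  by (simp add: Jordan total_variation_def abs_le_iff)

text \<open>The integral of a non-integrable function is \<open>0\<close> by convention, so integrals against \<open>\<mu>\<close> are additive only
  for functions that are integrable for both Jordan parts.\<close>

definition both_integrable :: "('b \<Rightarrow> real) \<Rightarrow> bool"
  where "both_integrable h \<longleftrightarrow> integrable (positive_part \<mu>) h \<and> integrable (negative_part \<mu>) h"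

lemma both_integrableI:
  assumes "h \<in> borel_measurable borel" "\<And>t. \<bar>h t\<bar> \<le> c"
  shows "both_integrable h"
proof -
  have [measurable]: "h \<in> borel_measurable borel" by fact
  show ?thesis
    unfolding both_integrable_def
    by (intro conjI pos.integrable_const_bound[of _ c] neg.integrable_const_bound[of _ c])
      (use assms(2) in auto)
qed

lemma both_integrable_bcontfun: "both_integrable (apply_bcontfun g)"
proof (rule both_integrableI)
  show "apply_bcontfun g \<in> borel_measurable borel"
    by (intro borel_measurable_continuous_onI) simp
  show "\<bar>apply_bcontfun g t\<bar> \<le> norm g" for t
    using norm_bounded[of g t] by simp
qed

lemma signed_integral_indicator: "A \<in> sets borel \<Longrightarrow> signed_integral \<mu> (indicator A) = \<mu> A"
  by (simp add: signed_integral_def Jordan)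

lemma signed_integral_add:
  "both_integrable g \<Longrightarrow> both_integrable h \<Longrightarrow>
    signed_integral \<mu> (\<lambda>t. g t + h t) = signed_integral \<mu> g + signed_integral \<mu> h"
  by (simp add: signed_integral_def both_integrable_def)

lemma signed_integral_diff:
  "both_integrable g \<Longrightarrow> both_integrable h \<Longrightarrow>
    signed_integral \<mu> (\<lambda>t. g t - h t) = signed_integral \<mu> g - signed_integral \<mu> h"
  by (simp add: signed_integral_def both_integrable_def)

lemma signed_integral_cmult:
  "signed_integral \<mu> (\<lambda>t. c * h t) = c * signed_integral \<mu> h"
  by (simp add: signed_integral_def right_diff_distrib)

text \<open>The bound by the variation of a set off which \<open>h\<close> vanishes serves three purposes: boundedness of
  integration on \<^term>\<open>C0\<close>, replacement of an indicator by a continuous function, and restriction to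
  a set that carries the measure.\<close>

lemma abs_signed_integral_le:
  assumes h: "h \<in> borel_measurable borel" and B: "B \<in> sets borel"
    and le: "\<And>t. \<bar>h t\<bar> \<le> c * indicator B t"
  shows "\<bar>signed_integral \<mu> h\<bar> \<le> c * total_variation \<mu> B"
proof -
  have [measurable]: "h \<in> borel_measurable borel" "B \<in> sets borel" by fact+
  have part: "\<bar>integral\<^sup>L M h\<bar> \<le> c * measure M B" if "finite_measure M" "sets M = sets borel" for M
  proof -
    interpret finite_measure M by fact
    have [measurable_cong]: "sets M = sets borel" by fact
    have int: "integrable M (\<lambda>t. c * indicator B t)"
      using that(2) B by (intro integrable_mult_right integrable_real_indicator) (auto simp: emeasure_eq_measure)
    then have "integrable M h"
      by (rule Bochner_Integration.integrable_bound) (use order_trans[OF le abs_ge_self] in auto)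
    then have "\<bar>integral\<^sup>L M h\<bar> \<le> (LINT t|M. c * indicator B t)"
      by (intro order_trans[OF integral_abs_bound] integral_mono int le) auto
    also have "\<dots> = c * measure M B"
      using sets_eq_imp_space_eq[OF that(2)] by simp
    finally show ?thesis .
  qed
  have "\<bar>signed_integral \<mu> h\<bar> \<le> \<bar>integral\<^sup>L (positive_part \<mu>) h\<bar> + \<bar>integral\<^sup>L (negative_part \<mu>) h\<bar>"
    by (simp add: signed_integral_def)
  also have "\<dots> \<le> c * total_variation \<mu> B"
    using part[OF pos.finite_measure_axioms] part[OF neg.finite_measure_axioms]
    by (simp add: total_variation_def distrib_left add_mono)
  finally show ?thesis .
qed

lemma abs_signed_integral_bcontfun_le:
  "\<bar>signed_integral \<mu> (apply_bcontfun g)\<bar> \<le> norm g * tv_norm \<mu>"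
  unfolding tv_norm_eq
proof (rule abs_signed_integral_le)
  show "apply_bcontfun g \<in> borel_measurable borel"
    by (intro borel_measurable_continuous_onI) simp
  show "\<bar>apply_bcontfun g t\<bar> \<le> norm g * indicator UNIV t" for t
    using norm_bounded[of g t] by simp
qed simp

lemma bounded_linear_signed_integral: "bounded_linear (\<lambda>g. signed_integral \<mu> (apply_bcontfun g))"
proof (rule bounded_linear_intro)
  show "signed_integral \<mu> (apply_bcontfun (g + h)) =
      signed_integral \<mu> (apply_bcontfun g) + signed_integral \<mu> (apply_bcontfun h)" for g h
    by (simp add: signed_integral_add both_integrable_bcontfun plus_bcontfun.rep_eq)
  show "signed_integral \<mu> (apply_bcontfun (c *\<^sub>R g)) = c *\<^sub>R signed_integral \<mu> (apply_bcontfun g)" for c g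
    by (simp add: signed_integral_cmult scaleR_bcontfun.rep_eq)
  show "norm (signed_integral \<mu> (apply_bcontfun g)) \<le> norm g * tv_norm \<mu>" for g
    using abs_signed_integral_bcontfun_le by simp
qed

end

section \<open>Regular measures are determined by their integrals\<close>

lemma signed_regular_imp_signed_borel_measure:
  "\<mu> \<in> signed_regular_measures \<Longrightarrow> signed_borel_measure \<mu>"
  by (simp add: signed_borel_measure_def signed_regular_imp_signed_measure)

text \<open>Inner and outer regularity are each used with error \<open>e / 2\<close>. The strict inequalities between the
  extended values can be moved to the reals because the total variation is finite.\<close>

lemma signed_regular_approx:
  fixes \<mu> :: "'b::t2_space set \<Rightarrow> real"
  assumes \<mu>: "\<mu> \<in> signed_regular_measures" and A: "A \<in> sets borel" and "0 < e"
  obtains C U where "compact C" "open U" "C \<subseteq> A" "A \<subseteq> U" "total_variation \<mu> (U - C) < e"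
proof -
  interpret signed_borel_measure \<mu>
    using \<mu> by (rule signed_regular_imp_signed_borel_measure)
  have reg: "variation \<mu> A = (INF U\<in>{U. open U \<and> A \<subseteq> U}. variation \<mu> U)"
    "variation \<mu> A = (SUP C\<in>{C. compact C \<and> C \<subseteq> A}. variation \<mu> C)"
    using \<mu> A unfolding signed_regular_measures_def by blast+
  have "(INF U\<in>{U. open U \<and> A \<subseteq> U}. variation \<mu> U) < ennreal (total_variation \<mu> A + e / 2)"
    using \<open>0 < e\<close> unfolding reg(1)[symmetric] variation_eq[OF A] by (intro ennreal_lessI) (auto simp: add_nonneg_pos)
  then obtain U where U: "open U" "A \<subseteq> U" "variation \<mu> U < ennreal (total_variation \<mu> A + e / 2)"
    unfolding INF_less_iff by blast
  have U_sets: "U \<in> sets borel"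
    using U(1) by simp
  have U_lt: "total_variation \<mu> U < total_variation \<mu> A + e / 2"
    using U(3) \<open>0 < e\<close> by (simp add: variation_eq[OF U_sets] ennreal_less_iff del: ennreal_plus)
  have "\<exists>C. compact C \<and> C \<subseteq> A \<and> total_variation \<mu> A - e / 2 < total_variation \<mu> C"
  proof (cases "total_variation \<mu> A < e / 2")
    case True
    then show ?thesis
      by (intro exI[of _ "{}"]) (simp add: total_variation_def)
  next
    case False
    then have "ennreal (total_variation \<mu> A - e / 2) < variation \<mu> A"
      using \<open>0 < e\<close> by (simp add: variation_eq[OF A] ennreal_less_iff)
    then obtain C where C: "compact C" "C \<subseteq> A" "ennreal (total_variation \<mu> A - e / 2) < variation \<mu> C"
      unfolding reg(2) less_SUP_iff by blast
    have "C \<in> sets borel"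
      using C(1) by (rule borel_compact)
    from C(3) have "total_variation \<mu> A - e / 2 < total_variation \<mu> C"
      using False unfolding variation_eq[OF \<open>C \<in> sets borel\<close>] by (simp add: ennreal_less_iff)
    with C show ?thesis by blast
  qed
  then obtain C where C: "compact C" "C \<subseteq> A" "total_variation \<mu> A - e / 2 < total_variation \<mu> C"
    by blast
  have "total_variation \<mu> (U - C) < e"
    using total_variation_Diff[of C U] U_sets U(2) U_lt C borel_compact[OF C(1)] by auto
  with C U show thesis
    using that by blast
qed

text \<open>A bump function that vanishes off \<open>U\<close> need not vanish at infinity. It does when it is made to vanish
  off \<open>U \<inter> V\<close> for a relatively compact neighbourhood \<open>V\<close> of \<open>C\<close>.\<close>

lemma Urysohn_C0:
  fixes C U :: "'b::t2_space set"
  assumes lc: "locally_compact_space (euclidean :: 'b topology)"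
    and "compact C" "open U" "C \<subseteq> U"
  obtains h where "h \<in> C0_functions" "\<And>t. 0 \<le> h t \<and> h t \<le> 1"
    "\<And>t. t \<in> C \<Longrightarrow> h t = 1" "\<And>t. t \<notin> U \<Longrightarrow> h t = 0"
proof -
  let ?X = "euclidean :: 'b topology"
  have hd: "Hausdorff_space ?X"
    by (simp add: Hausdorff_space_def disjnt_def) (meson hausdorff)
  obtain V L where V: "open V" "compact L" "C \<subseteq> V" "V \<subseteq> L"
    using lc \<open>compact C\<close> unfolding locally_compact_space_compact_closed_compact[OF disjI1[OF hd]]
    by auto
  have "completely_regular_space ?X"
    using lc hd locally_compact_Hausdorff_imp_regular_space locally_compact_regular_imp_completely_regular_space by blast
  then obtain h :: "'b \<Rightarrow> real" where h: "continuous_map ?X (top_of_set {0..1}) h"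
    "h ` (- (U \<inter> V)) \<subseteq> {0}" "h ` C \<subseteq> {1}"
    using Urysohn_completely_regular_compact_closed[of 0 1 ?X C "- (U \<inter> V)"] assms V
    by (auto simp: disjnt_def closed_Compl open_Int)
  show thesis
  proof
    have cont: "continuous_on UNIV h" and range: "\<And>t. h t \<in> {0..1}"
      using h(1) by (auto simp: continuous_map_in_subtopology)
    have "compact {t. \<epsilon> \<le> \<bar>h t\<bar>}" if "0 < \<epsilon>" for \<epsilon>
    proof (rule compact_Int_closed[OF V(2), of "{t. \<epsilon> \<le> \<bar>h t\<bar>}", THEN subst[of _ _ compact, rotated]])
      show "L \<inter> {t. \<epsilon> \<le> \<bar>h t\<bar>} = {t. \<epsilon> \<le> \<bar>h t\<bar>}"
        using h(2) V(4) that by fastforce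
      show "closed {t. \<epsilon> \<le> \<bar>h t\<bar>}"
        using cont by (intro closed_Collect_le continuous_intros)
    qed
    with cont show "h \<in> C0_functions"
      by (simp add: C0_functions_def)
    show "0 \<le> h t \<and> h t \<le> 1" for t
      using range[of t] by simp
    show "h t = 1" if "t \<in> C" for t
      using h(3) that by blast
    show "h t = 0" if "t \<notin> U" for t
      using h(2) that by blast
  qed
qed

text \<open>Uniqueness in the Riesz representation theorem: by regularity the indicator of a Borel set \<open>A\<close> is
  approximated, simultaneously for both measures, by a continuous function that differs from it only
  on a set of small variation. Off the Borel sets the two set functions agree by convention.\<close>

lemma signed_regular_measures_eqI:
  fixes \<mu> \<nu> :: "'b::t2_space set \<Rightarrow> real"
  assumes lc: "locally_compact_space (euclidean :: 'b topology)"
    and \<mu>: "\<mu> \<in> signed_regular_measures" and \<nu>: "\<nu> \<in> signed_regular_measures"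
    and eq: "\<And>h. h \<in> C0_functions \<Longrightarrow> signed_integral \<mu> h = signed_integral \<nu> h"
  shows "\<mu> = \<nu>"
proof
  fix A
  show "\<mu> A = \<nu> A"
  proof (cases "A \<in> sets borel")
    case False
    with \<mu> \<nu> show ?thesis
      by (simp add: signed_regular_measures_def)
  next
    case A: True
    have "\<bar>\<mu> A - \<nu> A\<bar> \<le> e" if e: "0 < e" for e
    proof -
      obtain C1 U1 where 1: "compact C1" "open U1" "C1 \<subseteq> A" "A \<subseteq> U1" "total_variation \<mu> (U1 - C1) < e / 2"
        using signed_regular_approx[OF \<mu> A half_gt_zero[OF e]] .
      obtain C2 U2 where 2: "compact C2" "open U2" "C2 \<subseteq> A" "A \<subseteq> U2" "total_variation \<nu> (U2 - C2) < e / 2"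
        using signed_regular_approx[OF \<nu> A half_gt_zero[OF e]] .
      have CU: "compact (C1 \<union> C2)" "open (U1 \<inter> U2)" "C1 \<union> C2 \<subseteq> U1 \<inter> U2"
        using 1 2 by (auto simp: compact_Un open_Int)
      obtain h where h: "h \<in> C0_functions" "\<And>t. 0 \<le> h t \<and> h t \<le> 1"
        "\<And>t. t \<in> C1 \<union> C2 \<Longrightarrow> h t = 1" "\<And>t. t \<notin> U1 \<inter> U2 \<Longrightarrow> h t = 0"
        using Urysohn_C0[OF lc CU] by blast
      have hm: "h \<in> borel_measurable borel"
        using h(1) by (auto simp: C0_functions_def intro: borel_measurable_continuous_onI)
      have bound: "\<bar>\<rho> A - signed_integral \<rho> h\<bar> < e / 2"
        if \<rho>: "\<rho> \<in> signed_regular_measures" and U: "open U" and C: "compact C"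
          and CU: "C \<subseteq> C1 \<union> C2" "U1 \<inter> U2 \<subseteq> U" and small: "total_variation \<rho> (U - C) < e / 2" for \<rho> C U
      proof -
        interpret signed_borel_measure \<rho>
          using \<rho> by (rule signed_regular_imp_signed_borel_measure)
        have "\<rho> A - signed_integral \<rho> h = signed_integral \<rho> (\<lambda>t. indicator A t - h t)"
          unfolding signed_integral_indicator[OF A, symmetric]
          by (rule signed_integral_diff[symmetric]; rule both_integrableI[of _ 1])
            (use A hm h(2) in \<open>auto simp: indicator_def\<close>)
        also have "\<bar>\<dots>\<bar> \<le> 1 * total_variation \<rho> (U - C)"
        proof (rule abs_signed_integral_le)
          show "(\<lambda>t. indicator A t - h t) \<in> borel_measurable borel"
            using A hm by measurable
          show "U - C \<in> sets borel"
            using U C by (intro sets.Diff borel_open borel_compact)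
          show "\<bar>indicator A t - h t\<bar> \<le> 1 * indicator (U - C) t" for t
            using h(2)[of t] h(3)[of t] h(4)[of t] CU 1(3,4) 2(3,4)
            by (auto simp: indicator_def)
        qed
        finally show ?thesis
          using small by simp
      qed
      have "\<bar>\<mu> A - signed_integral \<mu> h\<bar> < e / 2"
        by (rule bound[OF \<mu> 1(2,1) _ _ 1(5)]) auto
      moreover have "\<bar>\<nu> A - signed_integral \<nu> h\<bar> < e / 2"
        by (rule bound[OF \<nu> 2(2,1) _ _ 2(5)]) auto
      ultimately show ?thesis
        using eq[OF h(1)] by linarith
    qed
    then have "\<bar>\<mu> A - \<nu> A\<bar> \<le> 0"
      by (rule field_le_epsilon) simp
    then show ?thesis by simp
  qed
qed

lemma apply_Bcontfun_C0: "h \<in> C0_functions \<Longrightarrow> apply_bcontfun (Bcontfun h) = h"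
  using C0_functions_subset_bcontfun by (auto simp: Bcontfun_inverse)

text \<open>The set of functions that do not distinguish \<open>\<mu>\<close> from \<open>\<nu>\<close> is a closed subspace, since integration
  is continuous for the supremum norm. It contains the kernel sections, hence all of \<^term>\<open>C0\<close>.\<close>

lemma inj_on_rkbs_fun:
  fixes K :: "'a \<Rightarrow> 'b::t2_space \<Rightarrow> real"
  assumes lc: "locally_compact_space (euclidean :: 'b topology)"
    and K: "\<And>s. K s \<in> C0_functions"
    and dense: "C0 \<subseteq> closure (span (range (\<lambda>s. Bcontfun (K s))))"
  shows "inj_on (rkbs_fun K) signed_regular_measures"
proof (rule inj_onI)
  fix \<mu> \<nu> :: "'b set \<Rightarrow> real"
  assume \<mu>: "\<mu> \<in> signed_regular_measures" and \<nu>: "\<nu> \<in> signed_regular_measures"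
    and eq: "rkbs_fun K \<mu> = rkbs_fun K \<nu>"
  interpret m: signed_borel_measure \<mu>
    using \<mu> by (rule signed_regular_imp_signed_borel_measure)
  interpret n: signed_borel_measure \<nu>
    using \<nu> by (rule signed_regular_imp_signed_borel_measure)
  define D where "D g = signed_integral \<mu> (apply_bcontfun g) - signed_integral \<nu> (apply_bcontfun g)" for g
  have D: "bounded_linear D"
    unfolding D_def by (intro bounded_linear_sub m.bounded_linear_signed_integral n.bounded_linear_signed_integral)
  then have lin: "linear D"
    by (rule bounded_linear.linear)
  have "range (\<lambda>s. Bcontfun (K s)) \<subseteq> {g. D g = 0}"
    using fun_cong[OF eq] K by (auto simp: D_def rkbs_fun_def apply_Bcontfun_C0)
  then have "span (range (\<lambda>s. Bcontfun (K s))) \<subseteq> {g. D g = 0}"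
    by (rule span_minimal) (rule linear_subspace_kernel[OF lin])
  moreover have "closed {g. D g = 0}"
    using D by (intro closed_Collect_eq continuous_intros linear_continuous_on)
  ultimately have "C0 \<subseteq> {g. D g = 0}"
    using dense closure_minimal by blast
  then show "\<mu> = \<nu>"
    by (intro signed_regular_measures_eqI[OF lc \<mu> \<nu>])
      (auto simp: D_def C0_def apply_Bcontfun_C0 subset_iff)
qed

text \<open>Injectivity is what makes the definite description in the norm denote.\<close>

lemma rkbs_norm_rkbs_fun:
  assumes "inj_on (rkbs_fun K) signed_regular_measures" "\<mu> \<in> signed_regular_measures"
  shows "rkbs_norm K (rkbs_fun K \<mu>) = tv_norm \<mu>"
proof -
  have "(THE \<nu>. \<nu> \<in> signed_regular_measures \<and> rkbs_fun K \<mu> = rkbs_fun K \<nu>) = \<mu>"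
    using assms by (intro the_equality) (auto simp: inj_on_def)
  then show ?thesis
    by (simp add: rkbs_norm_def)
qed

section \<open>Discrete measures and measures carried by finite sets\<close>

context signed_borel_measure
begin

lemma total_variation_finite:
  fixes T :: "'b set"
  assumes "finite T" "\<And>t. t \<in> T \<Longrightarrow> {t} \<in> sets borel"
  shows "total_variation \<mu> T = (\<Sum>t\<in>T. total_variation \<mu> {t})"
  using assms by (simp add: total_variation_def sum.distrib
      pos.finite_measure_eq_sum_singleton neg.finite_measure_eq_sum_singleton)

lemma signed_integral_sum:
  assumes "finite I" "\<And>i. i \<in> I \<Longrightarrow> both_integrable (h i)"
  shows "signed_integral \<mu> (\<lambda>t. \<Sum>i\<in>I. h i t) = (\<Sum>i\<in>I. signed_integral \<mu> (h i))"
  using assms by (simp add: signed_integral_def both_integrable_def sum_subtractf)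

end

lemma signed_integral_concentrated:
  fixes \<mu> :: "'b::t2_space set \<Rightarrow> real"
  assumes "signed_borel_measure \<mu>" and T: "finite T" and conc: "total_variation \<mu> (- T) = 0"
  shows "signed_integral \<mu> (apply_bcontfun g) = (\<Sum>t\<in>T. \<mu> {t} * g t)"
proof -
  interpret signed_borel_measure \<mu> by fact
  have gm [measurable]: "apply_bcontfun g \<in> borel_measurable borel"
    by (intro borel_measurable_continuous_onI) simp
  have T_sets [measurable]: "T \<in> sets borel"
    using T by (intro borel_closed finite_imp_closed)
  define h where "h x = (\<Sum>t\<in>T. g t * indicator {t} x)" for x
  have h_eq: "h x = g x * indicator T x" for x
    using T by (auto simp: h_def indicator_def if_distrib[of "\<lambda>z. _ * z"] sum.delta cong: if_cong)
  have int: "both_integrable (\<lambda>x. g t * indicator {t} x)" for t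
    by (rule both_integrableI[of _ "norm g"])
      (use norm_bounded[of g t] in \<open>auto simp: indicator_def\<close>)
  have inth: "both_integrable h"
    by (rule both_integrableI[of _ "norm g"])
      (use norm_bounded[of g] in \<open>auto simp: h_eq[abs_def] indicator_def\<close>)
  have "\<bar>signed_integral \<mu> (\<lambda>x. g x - h x)\<bar> \<le> norm g * total_variation \<mu> (- T)"
    by (rule abs_signed_integral_le)
      (use norm_bounded[of g] in \<open>auto simp: h_eq[abs_def] indicator_def\<close>)
  then have "signed_integral \<mu> g = signed_integral \<mu> h"
    by (simp add: conc signed_integral_diff both_integrable_bcontfun inth)
  also have "\<dots> = (\<Sum>t\<in>T. g t * signed_integral \<mu> (indicator {t}))"
    unfolding h_def using T int by (subst signed_integral_sum) (auto simp: signed_integral_cmult)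
  also have "\<dots> = (\<Sum>t\<in>T. \<mu> {t} * g t)"
    by (simp add: signed_integral_indicator mult.commute)
  finally show ?thesis .
qed

text \<open>The measure \<open>\<Sum>t\<in>T. \<alpha> t \<cdot> \<delta>\<^sub>t\<close>. It is \<open>0\<close> off the Borel sets, as membership in
  \<^term>\<open>signed_regular_measures\<close> demands.\<close>

definition discrete_measure :: "'b::t2_space set \<Rightarrow> ('b \<Rightarrow> real) \<Rightarrow> 'b set \<Rightarrow> real"
  where "discrete_measure T \<alpha> A = (if A \<in> sets borel then \<Sum>t\<in>T. \<alpha> t * indicator A t else 0)"

lemma signed_borel_measure_discrete:
  "signed_borel_measure (discrete_measure T \<alpha>)"
proof (unfold signed_borel_measure_def, standard)
  fix A :: "nat \<Rightarrow> 'a set"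
  assume A: "range A \<subseteq> sets borel" "disjoint_family A"
  have "(\<lambda>i. \<Sum>t\<in>T. \<alpha> t * indicator (A i) t) sums (\<Sum>t\<in>T. \<alpha> t * indicator (\<Union>i. A i) t)"
    using A(2) by (intro sums_sum sums_mult indicator_sums) (auto simp: disjoint_family_on_def)
  moreover have "A i \<in> sets borel" for i
    using A(1) by blast
  ultimately show "(\<lambda>i. discrete_measure T \<alpha> (A i)) sums discrete_measure T \<alpha> (\<Union>i. A i)"
    by (simp add: discrete_measure_def)
qed

lemma discrete_measure_eq_sum:
  "finite T \<Longrightarrow> A \<in> sets borel \<Longrightarrow> discrete_measure T \<alpha> A = (\<Sum>t\<in>T \<inter> A. \<alpha> t)"
  by (simp add: discrete_measure_def indicator_def sum.inter_restrict if_distrib cong: if_cong)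

lemma discrete_measure_singleton:
  "finite T \<Longrightarrow> t \<in> T \<Longrightarrow> discrete_measure T \<alpha> {t} = \<alpha> t"
  by (simp add: discrete_measure_eq_sum)

text \<open>The upper bound is read off the defining supremum, the lower bound comes from the singletons.\<close>

lemma total_variation_discrete:
  assumes T: "finite T" and A: "A \<in> sets borel"
  shows "total_variation (discrete_measure T \<alpha>) A = (\<Sum>t\<in>T \<inter> A. \<bar>\<alpha> t\<bar>)"
proof (rule antisym)
  interpret signed_borel_measure "discrete_measure T \<alpha>"
    by (rule signed_borel_measure_discrete)
  interpret a: signed_borel_measure "discrete_measure T (\<lambda>t. \<bar>\<alpha> t\<bar>)"
    by (rule signed_borel_measure_discrete)
  have "variation (discrete_measure T \<alpha>) A \<le> ennreal (\<Sum>t\<in>T \<inter> A. \<bar>\<alpha> t\<bar>)"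
    unfolding variation_def
  proof (intro SUP_least ennreal_leI)
    fix P assume "P \<in> {P. finite P \<and> P \<subseteq> sets borel \<and> partition_on A P}"
    then have P: "finite P" "P \<subseteq> sets borel" "disjoint P" "A = \<Union>P"
      by (auto simp: partition_on_def)
    have "(\<Sum>E\<in>P. \<bar>discrete_measure T \<alpha> E\<bar>) \<le> (\<Sum>E\<in>P. discrete_measure T (\<lambda>t. \<bar>\<alpha> t\<bar>) E)"
      using P(2) by (intro sum_mono) (auto simp: discrete_measure_eq_sum[OF T] subset_iff intro: sum_abs)
    also have "\<dots> = (\<Sum>t\<in>T \<inter> A. \<bar>\<alpha> t\<bar>)"
      using a.Union[OF P(1-3)] A by (simp add: P(4)[symmetric] discrete_measure_eq_sum[OF T])
    finally show "(\<Sum>E\<in>P. \<bar>discrete_measure T \<alpha> E\<bar>) \<le> (\<Sum>t\<in>T \<inter> A. \<bar>\<alpha> t\<bar>)" .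
  qed
  then show "total_variation (discrete_measure T \<alpha>) A \<le> (\<Sum>t\<in>T \<inter> A. \<bar>\<alpha> t\<bar>)"
    by (simp add: variation_eq[OF A] ennreal_le_iff sum_nonneg)
  have "(\<Sum>t\<in>T \<inter> A. \<bar>\<alpha> t\<bar>) \<le> (\<Sum>t\<in>T \<inter> A. total_variation (discrete_measure T \<alpha>) {t})"
  proof (rule sum_mono)
    fix t assume "t \<in> T \<inter> A"
    then show "\<bar>\<alpha> t\<bar> \<le> total_variation (discrete_measure T \<alpha>) {t}"
      using abs_le_total_variation[of "{t}"] T by (simp add: discrete_measure_singleton)
  qed
  also have "\<dots> = total_variation (discrete_measure T \<alpha>) (T \<inter> A)"
    using T by (intro total_variation_finite[symmetric]) auto
  also have "\<dots> \<le> total_variation (discrete_measure T \<alpha>) A"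
    using A by (intro total_variation_mono) auto
  finally show "(\<Sum>t\<in>T \<inter> A. \<bar>\<alpha> t\<bar>) \<le> total_variation (discrete_measure T \<alpha>) A" .
qed

text \<open>Both approximations are exact: removing from the space the finitely many atoms outside of \<open>A\<close>
  leaves an open set, and the atoms inside \<open>A\<close> form a compact set.\<close>

lemma discrete_measure_regular:
  assumes T: "finite T"
  shows "discrete_measure T \<alpha> \<in> signed_regular_measures"
proof -
  interpret signed_borel_measure "discrete_measure T \<alpha>"
    by (rule signed_borel_measure_discrete)
  let ?v = "variation (discrete_measure T \<alpha>)"
  have v: "?v A = ennreal (\<Sum>t\<in>T \<inter> A. \<bar>\<alpha> t\<bar>)" if "A \<in> sets borel" for A
    using that T by (simp add: variation_eq total_variation_discrete)
  have mono: "?v A \<le> ?v B" if "A \<in> sets borel" "B \<in> sets borel" "A \<subseteq> B" for A B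
    unfolding v[OF that(1)] v[OF that(2)] using that(3) T
    by (intro ennreal_leI sum_mono2) auto
  have reg: "?v A = (INF U\<in>{U. open U \<and> A \<subseteq> U}. ?v U)"
    "?v A = (SUP C\<in>{C. compact C \<and> C \<subseteq> A}. ?v C)" if A: "A \<in> sets borel" for A
  proof -
    show "?v A = (INF U\<in>{U. open U \<and> A \<subseteq> U}. ?v U)"
    proof (rule antisym)
      show "?v A \<le> (INF U\<in>{U. open U \<and> A \<subseteq> U}. ?v U)"
        using A by (intro INF_greatest mono) auto
      have "open (- (T - A))"
        using T by (intro open_Compl finite_imp_closed) simp
      moreover have "T \<inter> - (T - A) = T \<inter> A"
        by blast
      ultimately have "?v (- (T - A)) = ?v A"
        using v[OF A] v[of "- (T - A)"] by simp
      then show "(INF U\<in>{U. open U \<and> A \<subseteq> U}. ?v U) \<le> ?v A"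
        using \<open>open (- (T - A))\<close> by (intro INF_lower2[of "- (T - A)"]) auto
    qed
    show "?v A = (SUP C\<in>{C. compact C \<and> C \<subseteq> A}. ?v C)"
    proof (rule antisym)
      show "(SUP C\<in>{C. compact C \<and> C \<subseteq> A}. ?v C) \<le> ?v A"
        using A by (intro SUP_least mono) (auto intro: borel_compact)
      have "compact (T \<inter> A)"
        using T by (intro finite_imp_compact) simp
      moreover have "T \<inter> (T \<inter> A) = T \<inter> A"
        by blast
      ultimately have "?v (T \<inter> A) = ?v A"
        using v[OF A] v[OF borel_compact, of "T \<inter> A"] by simp
      then show "?v A \<le> (SUP C\<in>{C. compact C \<and> C \<subseteq> A}. ?v C)"
        using \<open>compact (T \<inter> A)\<close> by (intro SUP_upper2[of "T \<inter> A"]) auto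
    qed
  qed
  show ?thesis
    unfolding signed_regular_measures_def
  proof (intro CollectI conjI allI ballI impI)
    fix A :: "'a set"
    assume "A \<notin> sets borel"
    then show "discrete_measure T \<alpha> A = 0"
      by (simp add: discrete_measure_def)
  next
    fix A :: "nat \<Rightarrow> 'a set"
    assume "range A \<subseteq> sets borel \<and> disjoint_family A"
    then show "(\<lambda>i. discrete_measure T \<alpha> (A i)) sums discrete_measure T \<alpha> (\<Union>i. A i)"
      by (intro sums_UN) blast+
  qed (fact reg)+
qed

lemma tv_norm_discrete:
  assumes "finite T"
  shows "tv_norm (discrete_measure T \<alpha>) = (\<Sum>t\<in>T. \<bar>\<alpha> t\<bar>)"
proof -
  interpret signed_borel_measure "discrete_measure T \<alpha>"
    by (rule signed_borel_measure_discrete)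
  show ?thesis
    using assms by (simp add: tv_norm_eq total_variation_discrete)
qed

lemma signed_integral_discrete:
  assumes T: "finite T" and h: "h \<in> C0_functions"
  shows "signed_integral (discrete_measure T \<alpha>) h = (\<Sum>t\<in>T. \<alpha> t * h t)"
proof -
  have "- T \<in> sets borel"
    using T by (intro borel_open open_Compl finite_imp_closed)
  then have "total_variation (discrete_measure T \<alpha>) (- T) = 0"
    using T by (simp add: total_variation_discrete)
  from signed_integral_concentrated[OF signed_borel_measure_discrete T this, of "Bcontfun h"] show ?thesis
    using T by (simp add: apply_Bcontfun_C0[OF h] discrete_measure_singleton)
qed

text \<open>Equality in \<open>\<integral>g d\<mu> \<le> \<parallel>g\<parallel> \<parallel>\<mu>\<parallel>\<close> says that the integrals of the nonnegative functions \<open>\<parallel>g\<parallel> - g\<close> and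
  \<open>\<parallel>g\<parallel> + g\<close> against the positive and the negative part of \<open>\<mu>\<close> vanish. So the positive part lives
  where \<open>g = \<parallel>g\<parallel>\<close> and the negative part where \<open>g = - \<parallel>g\<parallel>\<close>; the sign of an atom is the sign of \<open>g\<close>.\<close>

lemma norming_imp_concentrated:
  fixes \<mu> :: "'b::t2_space set \<Rightarrow> real"
  assumes "signed_borel_measure \<mu>"
    and norming: "signed_integral \<mu> (apply_bcontfun g) = norm g * tv_norm \<mu>"
  shows "total_variation \<mu> (- norm_set g) = 0"
    and "\<And>t. \<mu> {t} * g t = norm g * \<bar>\<mu> {t}\<bar>"
proof -
  interpret signed_borel_measure \<mu> by fact
  have gm [measurable]: "apply_bcontfun g \<in> borel_measurable borel"
    by (intro borel_measurable_continuous_onI) simp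
  have le: "0 \<le> norm g - g t" "0 \<le> norm g + g t" for t
    using norm_bounded[of g t] by auto
  have int: "integrable (positive_part \<mu>) (\<lambda>t. g t)" "integrable (negative_part \<mu>) (\<lambda>t. g t)"
    using both_integrable_bcontfun[of g] by (simp_all add: both_integrable_def)
  have "(LINT t|positive_part \<mu>. norm g - g t) + (LINT t|negative_part \<mu>. norm g + g t) =
      norm g * tv_norm \<mu> - signed_integral \<mu> g"
    using int by (simp add: signed_integral_def tv_norm_eq total_variation_def algebra_simps)
  also have "\<dots> = 0"
    using norming by simp
  finally have sum0: "(LINT t|positive_part \<mu>. norm g - g t) + (LINT t|negative_part \<mu>. norm g + g t) = 0" .
  have nonneg: "0 \<le> (LINT t|positive_part \<mu>. norm g - g t)" "0 \<le> (LINT t|negative_part \<mu>. norm g + g t)"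
    by (rule Bochner_Integration.integral_nonneg, use le(1) in simp)
      (rule Bochner_Integration.integral_nonneg, use le(2) in simp)
  have "(LINT t|positive_part \<mu>. norm g - g t) = 0"
    using sum0 nonneg by linarith
  then have AEp: "AE t in positive_part \<mu>. norm g - g t = 0"
    using le(1) int by (subst (asm) integral_nonneg_eq_0_iff_AE) simp_all
  have "(LINT t|negative_part \<mu>. norm g + g t) = 0"
    using sum0 nonneg by linarith
  then have AEn: "AE t in negative_part \<mu>. norm g + g t = 0"
    using le(2) int by (subst (asm) integral_nonneg_eq_0_iff_AE) simp_all
  have null: "measure M B = 0" if "AE t in M. t \<notin> B" "B \<in> sets M" for M :: "'b measure" and B
  proof -
    have "{t \<in> space M. \<not> t \<notin> B} = B"
      using sets.sets_into_space[OF that(2)] by blast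
    then show ?thesis
      using AE_iff_measurable[OF that(2), of "\<lambda>t. t \<notin> B"] that(1) by (simp add: measure_def)
  qed
  have closed: "- norm_set g \<in> sets borel"
  proof -
    have "closed (norm_set g)"
      unfolding norm_set_def by (intro closed_Collect_eq continuous_intros) auto
    then show ?thesis by simp
  qed
  have "AE t in positive_part \<mu>. t \<notin> - norm_set g"
    using AEp by (rule eventually_mono) (use norm_ge_zero[of g] in \<open>simp add: norm_set_def abs_if\<close>)
  then have "measure (positive_part \<mu>) (- norm_set g) = 0"
    using closed by (intro null) auto
  moreover have "AE t in negative_part \<mu>. t \<notin> - norm_set g"
    using AEn by (rule eventually_mono) (simp add: norm_set_def, use norm_ge_zero[of g] in linarith)
  then have "measure (negative_part \<mu>) (- norm_set g) = 0"
    using closed by (intro null) auto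
  ultimately show "total_variation \<mu> (- norm_set g) = 0"
    by (simp add: total_variation_def)
  have pos0: "measure (positive_part \<mu>) {t} = 0" if "g t \<noteq> norm g" for t
    using AEp that by (intro null) (auto elim!: eventually_mono)
  have neg0: "measure (negative_part \<mu>) {t} = 0" if "g t \<noteq> - norm g" for t
    using AEn that by (intro null) (auto elim!: eventually_mono)
  show "\<mu> {t} * g t = norm g * \<bar>\<mu> {t}\<bar>" for t
    using pos0[of t] neg0[of t] by (cases "g t = norm g"; cases "g t = - norm g") (auto simp: Jordan)
qed

section \<open>Supporting functionals and linear independence\<close>

text \<open>Let \<open>E\<close> be the absolutely convex hull of the range of \<open>k\<close>, the set of vectors of cost at most \<open>1\<close>. If
  \<open>y\<close> cannot be had at a cost below \<open>m\<close>, then \<open>y / m\<close> is not interior to \<open>E\<close> and a hyperplane separates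
  it from the interior, hence from \<open>E\<close> itself, because \<open>E\<close> spans and so has an interior that is dense in
  it. This is the duality between least norms and norming functionals.\<close>

lemma supporting_functional:
  fixes k :: "'b \<Rightarrow> 'c::euclidean_space" and y :: 'c
  assumes span: "\<And>c. c \<noteq> 0 \<Longrightarrow> \<exists>t. c \<bullet> k t \<noteq> 0"
    and cost: "\<And>T \<beta>. finite T \<Longrightarrow> y = (\<Sum>t\<in>T. \<beta> t *\<^sub>R k t) \<Longrightarrow> m \<le> (\<Sum>t\<in>T. \<bar>\<beta> t\<bar>)"
    and "0 < m"
  obtains c where "c \<noteq> 0" "\<And>t. m * \<bar>c \<bullet> k t\<bar> \<le> c \<bullet> y"
proof -
  define E where "E = {(\<Sum>t\<in>T. \<beta> t *\<^sub>R k t) | T \<beta>. finite T \<and> (\<Sum>t\<in>T. \<bar>\<beta> t\<bar>) \<le> 1}"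
  have kE: "k t \<in> E" "- k t \<in> E" for t
    unfolding E_def
    by (rule CollectI, rule exI[of _ "{t}"], rule exI[of _ "\<lambda>_. 1"], simp)
      (rule CollectI, rule exI[of _ "{t}"], rule exI[of _ "\<lambda>_. -1"], simp)
  have "convex E"
  proof (rule convexI)
    fix z w and u v :: real
    assume "z \<in> E" "w \<in> E" and uv: "0 \<le> u" "0 \<le> v" "u + v = 1"
    then obtain S T \<beta> \<gamma> where z: "z = (\<Sum>t\<in>S. \<beta> t *\<^sub>R k t)" "finite S" "(\<Sum>t\<in>S. \<bar>\<beta> t\<bar>) \<le> 1"
      and w: "w = (\<Sum>t\<in>T. \<gamma> t *\<^sub>R k t)" "finite T" "(\<Sum>t\<in>T. \<bar>\<gamma> t\<bar>) \<le> 1"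
      by (auto simp: E_def)
    \<comment> \<open>Both combinations are extended by zero to a common index set.\<close>
    define \<beta>' \<gamma>' where "\<beta>' t = (if t \<in> S then \<beta> t else 0)" and "\<gamma>' t = (if t \<in> T then \<gamma> t else 0)" for t
    have 1: "z = (\<Sum>t\<in>S \<union> T. \<beta>' t *\<^sub>R k t)" "w = (\<Sum>t\<in>S \<union> T. \<gamma>' t *\<^sub>R k t)"
      unfolding z(1) w(1) using z(2) w(2)
      by (intro sum.mono_neutral_cong_left; auto simp: \<beta>'_def \<gamma>'_def)+
    have 2: "(\<Sum>t\<in>S \<union> T. \<bar>\<beta>' t\<bar>) = (\<Sum>t\<in>S. \<bar>\<beta> t\<bar>)" "(\<Sum>t\<in>S \<union> T. \<bar>\<gamma>' t\<bar>) = (\<Sum>t\<in>T. \<bar>\<gamma> t\<bar>)"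
      using z(2) w(2) by (intro sum.mono_neutral_cong_right; auto simp: \<beta>'_def \<gamma>'_def)+
    have "u *\<^sub>R z + v *\<^sub>R w = (\<Sum>t\<in>S \<union> T. (u * \<beta>' t + v * \<gamma>' t) *\<^sub>R k t)"
      by (simp add: 1 scaleR_sum_right sum.distrib scaleR_left_distrib)
    moreover have "(\<Sum>t\<in>S \<union> T. \<bar>u * \<beta>' t + v * \<gamma>' t\<bar>) \<le> 1"
    proof -
      have "(\<Sum>t\<in>S \<union> T. \<bar>u * \<beta>' t + v * \<gamma>' t\<bar>) \<le> (\<Sum>t\<in>S \<union> T. u * \<bar>\<beta>' t\<bar> + v * \<bar>\<gamma>' t\<bar>)"
        using uv by (intro sum_mono order_trans[OF abs_triangle_ineq]) (simp add: abs_mult)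
      also have "\<dots> = u * (\<Sum>t\<in>S. \<bar>\<beta> t\<bar>) + v * (\<Sum>t\<in>T. \<bar>\<gamma> t\<bar>)"
        by (simp add: sum.distrib sum_distrib_left[symmetric] 2)
      also have "\<dots> \<le> u * 1 + v * 1"
        using uv z(3) w(3) by (intro add_mono mult_left_mono) auto
      finally show ?thesis using uv by simp
    qed
    ultimately show "u *\<^sub>R z + v *\<^sub>R w \<in> E"
      unfolding E_def using z(2) w(2) by (intro CollectI exI conjI; assumption?) auto
  qed
  have int: "interior E \<noteq> {}"
  proof
    assume "interior E = {}"
    then obtain a b where a: "a \<noteq> 0" "E \<subseteq> {z. a \<bullet> z = b}"
      using empty_interior_subset_hyperplane[OF \<open>convex E\<close>] by blast
    have "a \<bullet> k t = b" "a \<bullet> (- k t) = b" for t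
      using a(2) kE[of t] by blast+
    then have "a \<bullet> k t = 0" for t
      by (metis inner_minus_right eq_neg_iff_add_eq_0 double_eq_0_iff)
    with span[OF a(1)] show False by blast
  qed
  have not_int: "y /\<^sub>R m \<notin> interior E"
  proof
    define z where "z = y /\<^sub>R m"
    assume "y /\<^sub>R m \<in> interior E"
    then obtain e where e: "0 < e" "ball z e \<subseteq> E"
      unfolding z_def[symmetric] mem_interior by blast
    have "z \<noteq> 0"
      using cost[of "{}" "\<lambda>_. 0"] \<open>0 < m\<close> by (auto simp: z_def)
    \<comment> \<open>Half the radius of the ball, so that the stretched vector stays inside it.\<close>
    define d where "d = e / (2 * norm z)"
    have "0 < d"
      using e(1) \<open>z \<noteq> 0\<close> by (simp add: d_def)
    have "dist z ((1 + d) *\<^sub>R z) = d * norm z"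
      using \<open>0 < d\<close> by (simp add: dist_norm algebra_simps)
    also have "\<dots> < e"
      using e(1) \<open>z \<noteq> 0\<close> by (simp add: d_def)
    finally have "(1 + d) *\<^sub>R z \<in> E"
      using e(2) by auto
    then obtain T \<beta> where T: "(1 + d) *\<^sub>R z = (\<Sum>t\<in>T. \<beta> t *\<^sub>R k t)" "finite T" "(\<Sum>t\<in>T. \<bar>\<beta> t\<bar>) \<le> 1"
      by (auto simp: E_def)
    have "y = (m / (1 + d)) *\<^sub>R ((1 + d) *\<^sub>R z)"
      using \<open>0 < m\<close> \<open>0 < d\<close> by (simp add: z_def)
    also have "\<dots> = (\<Sum>t\<in>T. (m / (1 + d) * \<beta> t) *\<^sub>R k t)"
      unfolding T(1) by (simp add: scaleR_sum_right)
    finally have "m \<le> (\<Sum>t\<in>T. \<bar>m / (1 + d) * \<beta> t\<bar>)"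
      by (rule cost[OF T(2)])
    also have "\<dots> = m / (1 + d) * (\<Sum>t\<in>T. \<bar>\<beta> t\<bar>)"
      using \<open>0 < m\<close> \<open>0 < d\<close> by (simp add: abs_mult sum_distrib_left)
    also have "\<dots> \<le> m / (1 + d) * 1"
      using \<open>0 < m\<close> \<open>0 < d\<close> T(3) by (intro mult_left_mono) auto
    also have "\<dots> < m"
      using \<open>0 < m\<close> \<open>0 < d\<close> by (simp add: field_simps)
    finally show False by simp
  qed
  obtain c b where c: "c \<noteq> 0" "\<And>z. z \<in> interior E \<Longrightarrow> c \<bullet> z \<le> b" "b \<le> c \<bullet> (y /\<^sub>R m)"
    using separating_hyperplane_sets[of "interior E" "{y /\<^sub>R m}"] not_int int \<open>convex E\<close>
    by (auto simp: convex_interior)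
  have "E \<subseteq> closure (interior E)"
    using closure_subset convex_closure_interior[OF \<open>convex E\<close> int] by blast
  also have "\<dots> \<subseteq> {z. c \<bullet> z \<le> b}"
    using c(2) by (intro closure_minimal closed_halfspace_le) auto
  finally have E: "c \<bullet> z \<le> c \<bullet> (y /\<^sub>R m)" if "z \<in> E" for z
    using c(3) that by force
  have "m * \<bar>c \<bullet> k t\<bar> \<le> c \<bullet> y" for t
    using E[OF kE(1), of t] E[OF kE(2), of t] \<open>0 < m\<close>
    by (simp add: abs_if field_simps)
  with c(1) show thesis
    using that by blast
qed

text \<open>The family version of linear independence, which also excludes repetitions, gives
  independence of the set of values together with its cardinality.\<close>

lemma independent_imageI:
  fixes k :: "'b \<Rightarrow> 'c::real_vector"
  assumes J: "finite J"
    and zero: "\<And>\<beta> t. (\<Sum>t\<in>J. \<beta> t *\<^sub>R k t) = 0 \<Longrightarrow> t \<in> J \<Longrightarrow> \<beta> t = 0"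
  shows "inj_on k J" "independent (k ` J)"
proof -
  show inj: "inj_on k J"
  proof (rule inj_onI)
    fix a b assume ab: "a \<in> J" "b \<in> J" "k a = k b"
    show "a = b"
    proof (rule ccontr)
      assume "a \<noteq> b"
      define \<beta> :: "'b \<Rightarrow> real" where "\<beta> t = (if t = a then 1 else 0) - (if t = b then 1 else 0)" for t
      have "(\<Sum>t\<in>J. \<beta> t *\<^sub>R k t) = k a - k b"
        using J ab(1,2) by (simp add: \<beta>_def scaleR_left_diff_distrib sum_subtractf sum.delta
            if_distrib[of "\<lambda>r. r *\<^sub>R _"] cong: if_cong)
      then have "\<beta> a = 0"
        using ab by (intro zero) auto
      with \<open>a \<noteq> b\<close> show False by (simp add: \<beta>_def)
    qed
  qed
  show "independent (k ` J)"
  proof (rule independent_if_scalars_zero)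
    fix u v assume "(\<Sum>x\<in>k ` J. u x *\<^sub>R x) = 0" and v: "v \<in> k ` J"
    then have "(\<Sum>t\<in>J. u (k t) *\<^sub>R k t) = 0"
      by (simp add: sum.reindex[OF inj])
    with v show "u v = 0"
      using zero[of "\<lambda>t. u (k t)"] by blast
  qed (use J in simp)
qed

lemma sum_Bcontfun_eq_0:
  fixes h :: "'n::finite \<Rightarrow> 'b::topological_space \<Rightarrow>\<^sub>C real"
  assumes "inj h" "independent (range h)" "(\<Sum>i\<in>UNIV. c i *\<^sub>R h i) = 0"
  shows "c i = 0"
proof -
  have "(\<Sum>v\<in>range h. c (inv h v) *\<^sub>R v) = 0"
    using assms(1,3) by (simp add: sum.reindex)
  then have "c (inv h (h i)) = 0"
    using assms(2) by (intro independentD[of "range h" "range h"]) auto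
  then show ?thesis
    using assms(1) by simp
qed

lemma apply_bcontfun_sum: "apply_bcontfun (\<Sum>i\<in>I. h i) t = (\<Sum>i\<in>I. apply_bcontfun (h i) t)"
  by (induction I rule: infinite_finite_induct) (simp_all add: plus_bcontfun.rep_eq zero_bcontfun.rep_eq)

lemma norm_set_scaleR: "c \<noteq> 0 \<Longrightarrow> norm_set (c *\<^sub>R g) = norm_set g"
  by (simp add: norm_set_def scaleR_bcontfun.rep_eq abs_mult)

section \<open>Extreme solutions of the regularized problem\<close>

theorem theorem29:
  fixes K :: "'a \<Rightarrow> 'b::t2_space \<Rightarrow> real"
    and x :: "'n::finite \<Rightarrow> 'a"
    and y\<^sub>0 :: "real ^ 'n"
    and Q :: "real ^ 'n \<Rightarrow> real ^ 'n \<Rightarrow> real"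
    and r :: real
    and f :: "'a \<Rightarrow> real"
  assumes "locally_compact_space (euclidean :: 'b topology)"
    and "\<And>s. K s \<in> C0_functions"
    and "C0 \<subseteq> closure (span (range (\<lambda>s. Bcontfun (K s))))"
    and "inj x"
    and "inj (\<lambda>i. Bcontfun (K (x i)))"
    and "independent (range (\<lambda>i. Bcontfun (K (x i))))"
    and "r > 0"
    and "\<And>z. 0 \<le> Q y\<^sub>0 z"
    and "lower_semicontinuous (Q y\<^sub>0)"
    and "convex_on UNIV (Q y\<^sub>0)"
    and "\<And>g. g \<in> kernel_span K x \<Longrightarrow> g \<noteq> 0 \<Longrightarrow> finite (norm_set g)"
    and "f extreme_point_of (regularized_solutions K x (Q y\<^sub>0) r)"
    and "f \<noteq> 0"
  shows "\<exists>g M \<alpha> t.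
      g \<in> kernel_span K x \<and> g \<noteq> 0 \<and>
      0 < M \<and> M \<le> rank_on (norm_set g) (node_matrix K x) \<and>
      (\<forall>j\<in>{1..M::nat}. \<alpha> j \<noteq> 0 \<and> t j \<in> norm_set g) \<and>
      (\<Sum>j=1..M. \<bar>\<alpha> j\<bar>) = norm g \<and>
      f = (\<lambda>s. \<Sum>j=1..M. \<alpha> j * K s (t j))"
proof -
  note K = assms(2)
  have inj: "inj_on (rkbs_fun K) signed_regular_measures"
    using assms(1-3) by (rule inj_on_rkbs_fun)
  define B where "B i = Bcontfun (K (x i))" for i
  have B: "apply_bcontfun (B i) = K (x i)" for i
    unfolding B_def by (rule apply_Bcontfun_C0[OF K])
  define k where "k t = (\<chi> i. K (x i) t)" for t
  let ?q = "Q y\<^sub>0"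
  let ?S = "regularized_solutions K x ?q r"
  have fS: "f \<in> ?S" and extreme: "\<And>a b. a \<in> ?S \<Longrightarrow> b \<in> ?S \<Longrightarrow> f \<notin> open_segment a b"
    using assms(12) by (auto simp: extreme_point_of_def)
  have minimal: "?q (sampling x f) + r * rkbs_norm K f \<le> ?q (sampling x h) + r * rkbs_norm K h"
    if "h \<in> rkbs K" for h
    using fS that by (force simp: regularized_solutions_def is_arg_min_def)
  obtain \<mu> where \<mu>: "\<mu> \<in> signed_regular_measures" "f = rkbs_fun K \<mu>"
    using fS by (auto simp: regularized_solutions_def is_arg_min_def rkbs_def)
  interpret signed_borel_measure \<mu>
    using \<mu>(1) by (rule signed_regular_imp_signed_borel_measure)
  define m where "m = tv_norm \<mu>"
  define y where "y = sampling x f"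
  have norm_f: "rkbs_norm K f = m"
    unfolding \<mu>(2) m_def using inj \<mu>(1) by (rule rkbs_norm_rkbs_fun)

  have discrete: "rkbs_fun K (discrete_measure T \<beta>) \<in> rkbs K"
    "rkbs_norm K (rkbs_fun K (discrete_measure T \<beta>)) = (\<Sum>t\<in>T. \<bar>\<beta> t\<bar>)"
    "sampling x (rkbs_fun K (discrete_measure T \<beta>)) = (\<Sum>t\<in>T. \<beta> t *\<^sub>R k t)"
    "rkbs_fun K (discrete_measure T \<beta>) = (\<lambda>s. \<Sum>t\<in>T. \<beta> t * K s t)" if T: "finite T" for T \<beta>
  proof -
    note reg = discrete_measure_regular[OF T, of \<beta>]
    show "rkbs_fun K (discrete_measure T \<beta>) \<in> rkbs K"
      using reg by (simp add: rkbs_def)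
    show "rkbs_norm K (rkbs_fun K (discrete_measure T \<beta>)) = (\<Sum>t\<in>T. \<bar>\<beta> t\<bar>)"
      unfolding rkbs_norm_rkbs_fun[OF inj reg] by (rule tv_norm_discrete[OF T])
    show fun_eq: "rkbs_fun K (discrete_measure T \<beta>) = (\<lambda>s. \<Sum>t\<in>T. \<beta> t * K s t)"
      by (simp add: rkbs_fun_def signed_integral_discrete[OF T K])
    show "sampling x (rkbs_fun K (discrete_measure T \<beta>)) = (\<Sum>t\<in>T. \<beta> t *\<^sub>R k t)"
      unfolding fun_eq by (simp add: vec_eq_iff sampling_def k_def)
  qed
  \<comment> \<open>A discrete measure with the same samples has the same data term, so it cannot have a smaller norm.\<close>
  have cost: "m \<le> (\<Sum>t\<in>T. \<bar>\<beta> t\<bar>)" if T: "finite T" "y = (\<Sum>t\<in>T. \<beta> t *\<^sub>R k t)" for T \<beta>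
    using minimal[OF discrete(1)[OF T(1), of \<beta>]] \<open>r > 0\<close>
    unfolding discrete(2,3)[OF T(1)] norm_f T(2)[symmetric] y_def[symmetric] by simp

  have "0 < m"
  proof (rule ccontr)
    assume "\<not> 0 < m"
    then have "tv_norm \<mu> = 0"
      by (simp add: m_def tv_norm_eq order_antisym)
    then have "f s = 0" for s
      using abs_signed_integral_bcontfun_le[of "Bcontfun (K s)"]
      by (simp add: \<mu>(2) rkbs_fun_def apply_Bcontfun_C0[OF K])
    with \<open>f \<noteq> 0\<close> show False
      by (simp add: fun_eq_iff)
  qed

  define G where "G c = (\<Sum>i\<in>UNIV. (c $ i) *\<^sub>R B i)" for c :: "real ^ 'n"
  have G: "apply_bcontfun (G c) t = c \<bullet> k t" for c t
    by (simp add: G_def apply_bcontfun_sum scaleR_bcontfun.rep_eq B inner_vec_def k_def)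
  have G_nz: "G c \<noteq> 0" if "c \<noteq> 0" for c
  proof
    assume "G c = 0"
    have "inj B" "independent (range B)"
      using assms(5,6) by (simp_all add: B_def[abs_def])
    then have "c $ i = 0" for i
      using \<open>G c = 0\<close> unfolding G_def by (rule sum_Bcontfun_eq_0)
    with that show False
      by (simp add: vec_eq_iff)
  qed
  have "\<exists>t. c \<bullet> k t \<noteq> 0" if "c \<noteq> 0" for c
  proof (rule ccontr)
    assume "\<not> (\<exists>t. c \<bullet> k t \<noteq> 0)"
    then have "G c = 0"
      by (intro bcontfun_eqI) (simp add: G zero_bcontfun.rep_eq)
    with G_nz[OF that] show False ..
  qed
  from supporting_functional[OF this cost \<open>0 < m\<close>]
  obtain c where c: "c \<noteq> 0" "\<And>t. m * \<bar>c \<bullet> k t\<bar> \<le> c \<bullet> y"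
    by blast
  define g where "g = G c"
  have g_nz: "g \<noteq> 0"
    unfolding g_def using c(1) by (rule G_nz)
  have g_span: "g \<in> kernel_span K x"
    unfolding g_def G_def kernel_span_def B_def
    by (intro span_sum span_mul span_base) blast
  define T where "T = norm_set g"
  have T: "finite T"
    unfolding T_def using assms(11) g_span g_nz by blast

  have int_g: "signed_integral \<mu> g = c \<bullet> y"
  proof -
    have "signed_integral \<mu> g = (\<Sum>i\<in>UNIV. c $ i * signed_integral \<mu> (B i))"
      using linear_sum[OF bounded_linear.linear[OF bounded_linear_signed_integral], of "\<lambda>i. (c $ i) *\<^sub>R B i" UNIV]
      by (simp add: g_def G_def scaleR_bcontfun.rep_eq signed_integral_cmult)
    also have "\<dots> = c \<bullet> y"
      by (simp add: B y_def \<mu>(2) sampling_def rkbs_fun_def inner_vec_def)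
    finally show ?thesis .
  qed
  \<comment> \<open>The measure attains its norm on \<open>g\<close>: one inequality is the supporting property, the other holds for any function.\<close>
  have "norm g \<le> c \<bullet> y / m"
    using c(2) \<open>0 < m\<close> by (intro norm_bound) (simp add: g_def G field_simps)
  moreover have "signed_integral \<mu> g \<le> norm g * m"
    using abs_signed_integral_bcontfun_le[of g] by (simp add: m_def)
  ultimately have norming: "signed_integral \<mu> g = norm g * tv_norm \<mu>"
    using \<open>0 < m\<close> by (simp add: int_g m_def[symmetric] field_simps)
  note conc = norming_imp_concentrated[OF signed_borel_measure_axioms norming]
  have conc_T: "total_variation \<mu> (- T) = 0"
    unfolding T_def by (rule conc(1))

  define \<alpha> where "\<alpha> t = \<mu> {t}" for t
  define J where "J = {t \<in> T. \<alpha> t \<noteq> 0}"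
  have J: "finite J" "J \<subseteq> T"
    using T by (auto simp: J_def)
  have f_eq: "f = (\<lambda>s. \<Sum>t\<in>J. \<alpha> t * K s t)"
  proof
    fix s
    have "f s = (\<Sum>t\<in>T. \<alpha> t * K s t)"
      using signed_integral_concentrated[OF signed_borel_measure_axioms T conc_T, of "Bcontfun (K s)"]
      by (simp add: \<mu>(2) rkbs_fun_def apply_Bcontfun_C0[OF K] \<alpha>_def)
    also have "\<dots> = (\<Sum>t\<in>J. \<alpha> t * K s t)"
      using T by (intro sum.mono_neutral_right) (auto simp: J_def)
    finally show "f s = (\<Sum>t\<in>J. \<alpha> t * K s t)" .
  qed
  have sign: "\<alpha> t * g t = norm g * \<bar>\<alpha> t\<bar>" for t
    unfolding \<alpha>_def by (rule conc(2))
  have m_eq: "m = (\<Sum>t\<in>J. \<bar>\<alpha> t\<bar>)"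
  proof -
    have "norm g * m = (\<Sum>t\<in>T. \<mu> {t} * g t)"
      unfolding m_def norming[symmetric]
      using signed_integral_concentrated[OF signed_borel_measure_axioms T conc_T] .
    also have "\<dots> = (\<Sum>t\<in>J. \<mu> {t} * g t)"
      using T by (intro sum.mono_neutral_right) (auto simp: J_def \<alpha>_def)
    also have "\<dots> = norm g * (\<Sum>t\<in>J. \<bar>\<alpha> t\<bar>)"
      by (simp add: sum_distrib_left sign[unfolded \<alpha>_def] \<alpha>_def)
    finally show ?thesis
      using g_nz by simp
  qed
  have "J \<noteq> {}"
    using \<open>0 < m\<close> m_eq by auto
  have f_disc: "f = rkbs_fun K (discrete_measure J \<alpha>)"
    unfolding discrete(4)[OF J(1)] by (rule f_eq)
  have y_eq: "y = (\<Sum>t\<in>J. \<alpha> t *\<^sub>R k t)"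
    unfolding y_def f_disc by (rule discrete(3)[OF J(1)])

  \<comment> \<open>A dependency between the columns at the atoms moves \<open>f\<close> inside the solution set in two opposite directions.\<close>
  have indep: "\<beta> t\<^sub>0 = 0" if zero: "(\<Sum>t\<in>J. \<beta> t *\<^sub>R k t) = 0" and "t\<^sub>0 \<in> J" for \<beta> t\<^sub>0
  proof (rule ccontr)
    assume "\<beta> t\<^sub>0 \<noteq> 0"
    \<comment> \<open>Small enough that no weight crosses zero; the added one avoids division by zero.\<close>
    define e where "e = Min ((\<lambda>t. \<bar>\<alpha> t\<bar> / (\<bar>\<beta> t\<bar> + 1)) ` J)"
    have "0 < e"
      unfolding e_def using J(1) \<open>J \<noteq> {}\<close> by (subst Min_gr_iff) (auto simp: J_def divide_pos_pos add_nonneg_pos)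
    have e_le: "\<bar>e * \<beta> t\<bar> \<le> \<bar>\<alpha> t\<bar>" if "t \<in> J" for t
    proof -
      have "e \<le> \<bar>\<alpha> t\<bar> / (\<bar>\<beta> t\<bar> + 1)"
        unfolding e_def using J(1) that by (intro Min_le) auto
      then have "e * (\<bar>\<beta> t\<bar> + 1) \<le> \<bar>\<alpha> t\<bar>"
        by (simp add: pos_le_divide_eq add_nonneg_pos)
      then show ?thesis
        using \<open>0 < e\<close> by (simp add: abs_mult distrib_left)
    qed
    have sum_g: "(\<Sum>t\<in>J. \<beta> t * g t) = 0"
    proof -
      have "(\<Sum>t\<in>J. \<beta> t * g t) = c \<bullet> (\<Sum>t\<in>J. \<beta> t *\<^sub>R k t)"
        by (simp add: g_def G inner_sum_right)
      then show ?thesis by (simp add: zero)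
    qed
    define h where "h d = rkbs_fun K (discrete_measure J (\<lambda>t. \<alpha> t + d * \<beta> t))" for d
    have h_S: "h d \<in> ?S" if d: "\<bar>d\<bar> = e" for d
    proof -
      \<comment> \<open>With unchanged signs the norm is linear in the weights, and the dependency annihilates \<open>g\<close>.\<close>
      have "norm g * \<bar>\<alpha> t + d * \<beta> t\<bar> = (\<alpha> t + d * \<beta> t) * g t" if "t \<in> J" for t
      proof -
        have "\<bar>d * \<beta> t\<bar> \<le> \<bar>\<alpha> t\<bar>"
          using e_le[OF that] d \<open>0 < e\<close> by (simp add: abs_mult)
        moreover have "g t = norm g \<and> 0 < \<alpha> t \<or> g t = - norm g \<and> \<alpha> t < 0"
        proof -
          have "\<bar>g t\<bar> = norm g" "\<alpha> t \<noteq> 0"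
            using that by (auto simp: J_def T_def norm_set_def)
          then show ?thesis
            using sign[of t] g_nz by (cases "0 < \<alpha> t") (auto simp: abs_if split: if_splits)
        qed
        ultimately show ?thesis
          by (auto simp: abs_if split: if_splits) (simp_all add: algebra_simps)
      qed
      then have "norm g * (\<Sum>t\<in>J. \<bar>\<alpha> t + d * \<beta> t\<bar>) = (\<Sum>t\<in>J. (\<alpha> t + d * \<beta> t) * g t)"
        by (simp add: sum_distrib_left)
      also have "\<dots> = (\<Sum>t\<in>J. \<alpha> t * g t) + d * (\<Sum>t\<in>J. \<beta> t * g t)"
        by (simp add: distrib_right sum.distrib sum_distrib_left mult.assoc)
      also have "\<dots> = norm g * m"
        by (simp add: sum_g sign m_eq sum_distrib_left)
      finally have "(\<Sum>t\<in>J. \<bar>\<alpha> t + d * \<beta> t\<bar>) = m"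
        using g_nz by simp
      moreover have "(\<Sum>t\<in>J. (\<alpha> t + d * \<beta> t) *\<^sub>R k t) = y"
      proof -
        have "(\<Sum>t\<in>J. (\<alpha> t + d * \<beta> t) *\<^sub>R k t) = y + d *\<^sub>R (\<Sum>t\<in>J. \<beta> t *\<^sub>R k t)"
          by (simp add: y_eq scaleR_left_distrib sum.distrib scaleR_sum_right)
        then show ?thesis by (simp add: zero)
      qed
      ultimately have "?q (sampling x (h d)) + r * rkbs_norm K (h d) = ?q (sampling x f) + r * rkbs_norm K f"
        unfolding h_def discrete(2,3)[OF J(1)] by (simp add: norm_f y_def)
      moreover have "h d \<in> rkbs K"
        unfolding h_def by (rule discrete(1)[OF J(1)])
      ultimately show ?thesis
        using minimal by (simp add: regularized_solutions_def is_arg_min_def not_less)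
    qed
    have "h e \<noteq> h (- e)"
    proof
      assume "h e = h (- e)"
      then have "discrete_measure J (\<lambda>t. \<alpha> t + e * \<beta> t) = discrete_measure J (\<lambda>t. \<alpha> t + - e * \<beta> t)"
        unfolding h_def by (rule inj_onD[OF inj _ discrete_measure_regular[OF J(1)] discrete_measure_regular[OF J(1)]])
      then have "\<alpha> t\<^sub>0 + e * \<beta> t\<^sub>0 = \<alpha> t\<^sub>0 + - e * \<beta> t\<^sub>0"
        using discrete_measure_singleton[OF J(1) \<open>t\<^sub>0 \<in> J\<close>] by metis
      with \<open>0 < e\<close> \<open>\<beta> t\<^sub>0 \<noteq> 0\<close> show False by simp
    qed
    moreover have "f = (1 - 1 / 2) *\<^sub>R h e + (1 / 2) *\<^sub>R h (- e)"
    proof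
      fix s
      have "(\<Sum>t\<in>J. \<alpha> t * K s t) = 1 / 2 * (\<Sum>t\<in>J. (\<alpha> t + e * \<beta> t) * K s t) + 1 / 2 * (\<Sum>t\<in>J. (\<alpha> t + - e * \<beta> t) * K s t)"
        unfolding distrib_left[symmetric] sum.distrib[symmetric] sum_distrib_left
        by (intro sum.cong) (simp_all add: algebra_simps)
      then show "f s = ((1 - 1 / 2) *\<^sub>R h e + (1 / 2) *\<^sub>R h (- e)) s"
        by (simp add: f_eq h_def discrete(4)[OF J(1)])
    qed
    ultimately have "f \<in> open_segment (h e) (h (- e))"
      unfolding in_segment by (intro conjI exI[of _ "1 / 2"]) auto
    then show False
      using extreme[OF h_S h_S, of e "- e"] \<open>0 < e\<close> by simp
  qed
  have indep_k: "inj_on k J" "independent (k ` J)"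
  proof -
    have "\<beta> t = 0" if "(\<Sum>t\<in>J. \<beta> t *\<^sub>R k t) = 0" "t \<in> J" for \<beta> t
      using that by (rule indep)
    then show "inj_on k J" "independent (k ` J)"
      using independent_imageI[OF J(1), of k] by blast+
  qed

  have rank: "card J \<le> rank_on T (node_matrix K x)"
  proof -
    have "card J = dim (k ` J)"
      using indep_k by (simp add: card_image dim_eq_card_independent)
    also have "\<dots> \<le> dim (k ` T)"
      using J(2) by (intro dim_subset image_mono)
    finally show ?thesis
      by (simp add: rank_on_def node_matrix_def k_def[abs_def])
  qed
  obtain t where t: "bij_betw t {1..card J} J"
    using ex_bij_betw_nat_finite_1[OF J(1)] by blast
  have reindex: "(\<Sum>j=1..card J. F (t j)) = (\<Sum>s\<in>J. F s)" for F :: "'b \<Rightarrow> real"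
    using t by (rule sum.reindex_bij_betw)
  have t_J: "t j \<in> J" if "j \<in> {1..card J}" for j
    using t that by (auto simp: bij_betw_def)
  \<comment> \<open>Any nonzero multiple of \<open>g\<close> has the same norming points; this one has the norm of \<open>\<mu>\<close>.\<close>
  define g' where "g' = (m / norm g) *\<^sub>R g"
  have scale: "m / norm g \<noteq> 0"
    using \<open>0 < m\<close> g_nz by simp
  have norm_set: "norm_set g' = T"
    unfolding g'_def T_def using scale by (rule norm_set_scaleR)
  show ?thesis
  proof (intro exI conjI ballI)
    show "g' \<in> kernel_span K x"
      using g_span unfolding g'_def kernel_span_def by (rule span_mul)
    show "g' \<noteq> 0"
      using scale g_nz by (simp add: g'_def)
    show "0 < card J"
      using J(1) \<open>J \<noteq> {}\<close> by (simp add: card_gt_0_iff)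
    show "card J \<le> rank_on (norm_set g') (node_matrix K x)"
      unfolding norm_set by (rule rank)
    show "(\<alpha> \<circ> t) j \<noteq> 0" "t j \<in> norm_set g'" if "j \<in> {1..card J}" for j
      using t_J[OF that] by (auto simp: norm_set J_def)
    show "(\<Sum>j=1..card J. \<bar>(\<alpha> \<circ> t) j\<bar>) = norm g'"
      using reindex[of "\<lambda>s. \<bar>\<alpha> s\<bar>"] \<open>0 < m\<close> g_nz by (simp add: g'_def m_eq[symmetric])
    show "f = (\<lambda>s. \<Sum>j=1..card J. (\<alpha> \<circ> t) j * K s (t j))"
      using reindex[of "\<lambda>u. \<alpha> u * K _ u"] by (simp add: f_eq)
  qed
qed

end
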